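(* Let $X\subseteq\mathcal{A}^{\mathbb{Z}}$ be a subshift, let $\mu$ be a $\sigma$-invariant probability measure with support $X$, and let $D_X$ be the associated operator on $L^2(X,\mu)$. 1. If $s>h(X)$, then $e^{-sD_X}$ is trace class. 2. If $s>0$ is such that $e^{-sD_X}$ is trace class, then $s\ge h(X)$.
   Context: Let $\mathcal{A}$ be a finite set and $\sigma$ the left shift on $\mathcal{A}^{\mathbb{Z}}$, $\sigma(x)_n=x_{n+1}$. A subshift is a non-empty closed set $X\subseteq\mathcal{A}^{\mathbb{Z}}$ with $\sigma(X)=X$. For $n\ge1$, $X_n=\{(x_1,\dots,x_n):x\in X\}$. The entropy of $X$ is $h(X)=\lim_{n\to\infty}\frac{\log(\#X_n)}{n}=\inf_{n\ge1}\frac{\log(\#X_n)}{n}$, where $\log$ is the natural logarithm. For $w\in X_n$, the cylinder set is $U(w)=\{x\in X:(x_{-m},\dots,x_m)=w\}$ if $n=2m+1$, and $U(w)=\{x\in X:(x_{1-m},\dots,x_m)=w\}$ if $n=2m\ge2$; $\xi(w)$ is the characteristic function of $U(w)$. Set $C_{-1}=\{0\}$, $C_0=\mathbb{C}1$, $C_n=\mathrm{span}\{\xi(w):w\in X_n\}\subseteq L^2(X,\mu)$ for $n\ge1$. $D_X$ is the operator on $L^2(X,\mu)$ with domain $\{\sum_{n\ge0}\xi_n:\xi_n\in C_n\cap C_{n-1}^\perp,\ \sum_n(n\|\xi_n\|)^2<\infty\}$ and $D_X\xi=n\xi$ for $\xi\in C_n\cap C_{n-1}^\perp$, $n\ge0$.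 *)

theory Defs
  imports "HOL-Probability.Probability_Measure"
begin

section \<open>Subshifts and entropy\<close>

definition shift :: "(int \<Rightarrow> 'a) \<Rightarrow> int \<Rightarrow> 'a" where
  "shift x = (\<lambda>n. x (n + 1))"

definition full_shift_topology :: "'a set \<Rightarrow> (int \<Rightarrow> 'a) topology" where
  "full_shift_topology A = product_topology (\<lambda>_. discrete_topology A) UNIV"

definition subshift :: "'a set \<Rightarrow> (int \<Rightarrow> 'a) set \<Rightarrow> bool" where
  "subshift A X \<longleftrightarrow> X \<noteq> {} \<and> closedin (full_shift_topology A) X \<and> shift ` X = X"

definition words :: "(int \<Rightarrow> 'a) set \<Rightarrow> nat \<Rightarrow> 'a list set" where
  "words X n = (\<lambda>x. map x [1..int n]) ` X"

definition subshift_entropy :: "(int \<Rightarrow> 'a) set \<Rightarrow> real" where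
  "subshift_entropy X = lim (\<lambda>n. ln (real (card (words X n))) / real n)"

definition cylinder :: "(int \<Rightarrow> 'a) set \<Rightarrow> 'a list \<Rightarrow> (int \<Rightarrow> 'a) set" where
  "cylinder X w =
    (let m = int (length w div 2)
     in if odd (length w) then {x \<in> X. map x [- m..m] = w} else {x \<in> X. map x [1 - m..m] = w})"

section \<open>Invariant measures\<close>

definition borel_measure_on :: "'b topology \<Rightarrow> 'b measure \<Rightarrow> bool" where
  "borel_measure_on T M \<longleftrightarrow> space M = topspace T \<and> sets M = sigma_sets (topspace T) {U. openin T U}"

definition measure_support :: "'b topology \<Rightarrow> 'b measure \<Rightarrow> 'b set" where
  "measure_support T M = {x \<in> topspace T. \<forall>U. openin T U \<and> x \<in> U \<longrightarrow> emeasure M U > 0}"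

definition invariant_measure :: "('b \<Rightarrow> 'b) \<Rightarrow> 'b measure \<Rightarrow> bool" where
  "invariant_measure f M \<longleftrightarrow> f \<in> measurable M M \<and> distr M M f = M"

section \<open>The Hilbert space of square-integrable functions\<close>

text \<open>
  Elements of the Hilbert space are represented by square-integrable functions; two functions
  represent the same vector iff they agree almost everywhere, i.e. iff their difference has
  norm zero. A set of functions stands for the set of vectors represented by its members.
\<close>

definition L2 :: "'b measure \<Rightarrow> ('b \<Rightarrow> complex) set" where
  "L2 M = {f \<in> borel_measurable M. integrable M (\<lambda>x. (norm (f x))\<^sup>2)}"

definition L2_inner :: "'b measure \<Rightarrow> ('b \<Rightarrow> complex) \<Rightarrow> ('b \<Rightarrow> complex) \<Rightarrow> complex" where
  "L2_inner M f g = (\<integral>x. f x * cnj (g x) \<partial>M)"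

definition L2_norm :: "'b measure \<Rightarrow> ('b \<Rightarrow> complex) \<Rightarrow> real" where
  "L2_norm M f = sqrt (\<integral>x. (norm (f x))\<^sup>2 \<partial>M)"

definition L2_sums :: "'b measure \<Rightarrow> (nat \<Rightarrow> 'b \<Rightarrow> complex) \<Rightarrow> ('b \<Rightarrow> complex) \<Rightarrow> bool" where
  "L2_sums M v f \<longleftrightarrow> (\<forall>n. v n \<in> L2 M) \<and> f \<in> L2 M \<and>
     (\<lambda>N. L2_norm M (\<lambda>x. (\<Sum>n<N. v n x) - f x)) \<longlonglongrightarrow> 0"

definition L2_orthogonal :: "'b measure \<Rightarrow> ('b \<Rightarrow> complex) set \<Rightarrow> ('b \<Rightarrow> complex) set" where
  "L2_orthogonal M S = {f \<in> L2 M. \<forall>g\<in>S. L2_inner M f g = 0}"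

definition L2_orthonormal_basis :: "'b measure \<Rightarrow> ('b \<Rightarrow> complex) set \<Rightarrow> bool" where
  "L2_orthonormal_basis M E \<longleftrightarrow> E \<subseteq> L2 M \<and>
     (\<forall>e\<in>E. L2_norm M e = 1) \<and>
     (\<forall>e\<in>E. \<forall>e'\<in>E. e \<noteq> e' \<longrightarrow> L2_inner M e e' = 0) \<and>
     (\<forall>f\<in>L2_orthogonal M E. L2_norm M f = 0)"

section \<open>Operators\<close>

text \<open>
  A (possibly unbounded) operator is given by its graph, a set of pairs of representatives;
  its domain of definition is \<^const>\<open>Domain\<close> of the graph.
\<close>

type_synonym 'b L2_operator = "(('b \<Rightarrow> complex) \<times> ('b \<Rightarrow> complex)) set"

text \<open>
  The graph determines the image of a vector only up to a null function; an arbitrary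
  representative is chosen.
\<close>

definition op_app :: "'b L2_operator \<Rightarrow> ('b \<Rightarrow> complex) \<Rightarrow> 'b \<Rightarrow> complex" where
  "op_app T f = (SOME g. (f, g) \<in> T)"

text \<open>
  Everywhere defined bounded linear operators. The bound, applied to the difference of two
  pairs in the graph, forces the graph to be single-valued up to almost everywhere equality.
\<close>

definition L2_bounded_operator :: "'b measure \<Rightarrow> 'b L2_operator \<Rightarrow> bool" where
  "L2_bounded_operator M T \<longleftrightarrow> T \<subseteq> L2 M \<times> L2 M \<and> Domain T = L2 M \<and>
     (\<forall>(f, g)\<in>T. \<forall>(f', g')\<in>T. ((\<lambda>x. f x + f' x), (\<lambda>x. g x + g' x)) \<in> T) \<and>
     (\<forall>(f, g)\<in>T. \<forall>c. ((\<lambda>x. c * f x), (\<lambda>x. c * g x)) \<in> T) \<and>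
     (\<exists>B. \<forall>(f, g)\<in>T. L2_norm M g \<le> B * L2_norm M f)"

definition L2_positive_operator :: "'b measure \<Rightarrow> 'b L2_operator \<Rightarrow> bool" where
  "L2_positive_operator M P \<longleftrightarrow> L2_bounded_operator M P \<and>
     (\<forall>f\<in>L2 M. L2_inner M (op_app P f) f \<in> \<real> \<and> 0 \<le> Re (L2_inner M (op_app P f) f))"

text \<open>
  \<open>P\<close> is the absolute value of \<open>T\<close>: it is positive, and its square is the adjoint of \<open>T\<close>
  composed with \<open>T\<close>. The latter identity is tested against vectors, using that a positive
  operator on a complex Hilbert space is self-adjoint.
\<close>

definition L2_absolute_value :: "'b measure \<Rightarrow> 'b L2_operator \<Rightarrow> 'b L2_operator \<Rightarrow> bool" where
  "L2_absolute_value M T P \<longleftrightarrow> L2_positive_operator M P \<and>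
     (\<forall>f\<in>L2 M. \<forall>g\<in>L2 M.
        L2_inner M (op_app P f) (op_app P g) = L2_inner M (op_app T f) (op_app T g))"

text \<open>
  \<open>T\<close> is trace class iff its absolute value has finite trace with respect to an orthonormal
  basis (by positivity, the choice of the basis does not matter).
\<close>

definition trace_class :: "'b measure \<Rightarrow> 'b L2_operator \<Rightarrow> bool" where
  "trace_class M T \<longleftrightarrow> L2_bounded_operator M T \<and>
     (\<exists>P E. L2_absolute_value M T P \<and> L2_orthonormal_basis M E \<and>
        (\<lambda>e. Re (L2_inner M (op_app P e) e)) summable_on E)"

text \<open>
  Functional calculus for an operator that is diagonalised by an orthogonal family of
  eigenvectors with real eigenvalues: if \<open>D v\<^sub>k = l\<^sub>k v\<^sub>k\<close> with the \<open>v\<^sub>k\<close> pairwise orthogonal,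
  then \<open>\<phi>(D)\<close> maps \<open>\<Sum>\<^sub>k v\<^sub>k\<close> to \<open>\<Sum>\<^sub>k \<phi>(l\<^sub>k) v\<^sub>k\<close>, provided both series converge. The \<open>v\<^sub>k\<close> may vanish.
\<close>

definition op_fun :: "'b measure \<Rightarrow> (real \<Rightarrow> real) \<Rightarrow> 'b L2_operator \<Rightarrow> 'b L2_operator" where
  "op_fun M \<phi> D = {(f, g). \<exists>v l.
     (\<forall>k. (v k, \<lambda>x. of_real (l k) * v k x) \<in> D) \<and>
     (\<forall>j k. j \<noteq> k \<longrightarrow> L2_inner M (v j) (v k) = 0) \<and>
     L2_sums M v f \<and> L2_sums M (\<lambda>k x. of_real (\<phi> (l k)) * v k x) g}"

definition op_exp :: "'b measure \<Rightarrow> real \<Rightarrow> 'b L2_operator \<Rightarrow> 'b L2_operator" where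
  "op_exp M t D = op_fun M (\<lambda>l. exp (t * l)) D"

section \<open>The operator of a subshift\<close>

text \<open>
  The spaces $C_n$, indexed by integers \<open>n \<ge> -1\<close>; for \<open>n \<ge> 1\<close> the span of the finitely many
  characteristic functions of cylinder sets is written out.
\<close>

definition cyl_space :: "(int \<Rightarrow> 'a) set \<Rightarrow> int \<Rightarrow> ((int \<Rightarrow> 'a) \<Rightarrow> complex) set" where
  "cyl_space X n =
    (if n < 0 then {\<lambda>_. 0}
     else if n = 0 then {\<lambda>_. c | c. True}
     else {\<lambda>x. \<Sum>w\<in>words X (nat n). c w * indicator (cylinder X w) x | c. True})"

definition D_operator ::
    "(int \<Rightarrow> 'a) set \<Rightarrow> (int \<Rightarrow> 'a) measure \<Rightarrow> (int \<Rightarrow> 'a) L2_operator" where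
  "D_operator X M = {(f, g). \<exists>v.
     (\<forall>n. v n \<in> cyl_space X (int n) \<inter> L2_orthogonal M (cyl_space X (int n - 1))) \<and>
     summable (\<lambda>n. (real n * L2_norm M (v n))\<^sup>2) \<and>
     L2_sums M v f \<and> L2_sums M (\<lambda>n x. of_nat n * v n x) g}"

end

theory Submission
  imports Defs
begin

text \<open>
  Write \<open>V n\<close> (\<open>eigenspace n\<close> below) for the orthogonal complement of \<open>C (n - 1)\<close> in \<open>C n\<close>. The operator \<open>D\<close> is
  multiplication by \<open>n\<close> on \<open>V n\<close>, so \<open>T = exp (- s D)\<close> is multiplication by \<open>exp (- s n)\<close> there. For
  \<open>s > 0\<close> it is bounded and positive, hence equal to its own absolute value, and its trace is the sum
  of \<open>exp (- s n) dim (V n)\<close>. Since the support of the measure is \<open>X\<close>, every cylinder has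
  positive measure; the normalised characteristic functions of the cylinders of length \<open>n\<close>
  are therefore an orthonormal basis of \<open>C n\<close>, and \<open>dim (C n)\<close> is the number of words of length \<open>n\<close>.
  By definition of the entropy \<open>h\<close> this number grows like \<open>exp (h n)\<close>, so that the
  trace is finite for \<open>s > h\<close> and infinite for \<open>s < h\<close>.

  The trace is estimated with respect to an arbitrary orthonormal basis \<open>E\<close>. If \<open>s > h\<close>, then
  \<open>\<langle>T e, e\<rangle>\<close> is the sum over \<open>n\<close> of \<open>exp (- s n)\<close> times the squared norm of the \<open>V n\<close>-component of \<open>e\<close>.
  That component is dominated by the projection of \<open>e\<close> to \<open>C n\<close>, and Bessel's inequality, applied to
  \<open>E\<close> and the basis vectors of \<open>C n\<close>, bounds the trace by the sum of \<open>exp (- s n) dim (C n)\<close>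
  (\<open>exp_op_trace_class\<close>), which converges.

  Conversely let \<open>P\<close> be any positive operator whose square is the square of \<open>T\<close>. The space \<open>V n\<close> consists of
  eigenvectors of \<open>P\<close> for \<open>exp (- s n)\<close> (\<open>L2_absolute_value_eigenvector\<close>), so the quadratic form of
  \<open>P\<close> at \<open>e\<close> is at least \<open>exp (- s N)\<close> times the squared norm of the projection of \<open>e\<close> to \<open>C N\<close>.
  Summing over \<open>e\<close> with Parseval's identity gives \<open>exp (- s N) dim (C N) \<le> trace P\<close> for
  every \<open>N\<close> (\<open>trace_class_exp_op_dimension_bound\<close>), hence \<open>h \<le> s\<close>.

  Three analytic facts support this: completeness of the space of square-integrable functions
  (\<open>L2_complete\<close>), which turns a maximal orthonormal set into one satisfying Parseval's identity;
  the density of the union of the \<open>C n\<close>, which holds because cylinders form a generator of the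
  \<open>\<sigma>\<close>-algebra that is stable under intersection (\<open>L2_null_if_orthogonal_cylinders\<close>); and Fekete's
  lemma (\<open>subadditive_convergent\<close>), by which the entropy is a genuine limit.
\<close>

section \<open>Square-integrable functions\<close>

lemma L2_measurable: "f \<in> L2 M \<Longrightarrow> f \<in> borel_measurable M"
  by (simp add: L2_def)

lemma L2_square_integrable: "f \<in> L2 M \<Longrightarrow> integrable M (\<lambda>x. (norm (f x))\<^sup>2)"
  by (simp add: L2_def)

lemma measurable_cnj [measurable (raw)]:
  "f \<in> borel_measurable M \<Longrightarrow> (\<lambda>x. cnj (f x)) \<in> borel_measurable M"
  by (rule borel_measurable_continuous_on[where f = cnj]) (auto intro: continuous_intros)

lemma L2_mult_integrable:
  assumes "f \<in> L2 M" "g \<in> L2 M"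
  shows "integrable M (\<lambda>x. f x * cnj (g x))"
proof (rule Bochner_Integration.integrable_bound[where f = "\<lambda>x. (norm (f x))\<^sup>2 + (norm (g x))\<^sup>2"])
  note [measurable] = assms[THEN L2_measurable]
  show "integrable M (\<lambda>x. (norm (f x))\<^sup>2 + (norm (g x))\<^sup>2)"
    using assms by (intro Bochner_Integration.integrable_add L2_square_integrable)
  show "(\<lambda>x. f x * cnj (g x)) \<in> borel_measurable M" by measurable
  have "norm (f x * cnj (g x)) \<le> (norm (f x))\<^sup>2 + (norm (g x))\<^sup>2" for x
  proof -
    have "norm (f x) * norm (g x) \<le> 2 * (norm (f x) * norm (g x))" by simp
    also have "\<dots> \<le> (norm (f x))\<^sup>2 + (norm (g x))\<^sup>2"
      using sum_squares_bound[of "norm (f x)" "norm (g x)"] by simp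
    finally show ?thesis by (simp add: norm_mult)
  qed
  then show "AE x in M. norm (f x * cnj (g x)) \<le> norm ((norm (f x))\<^sup>2 + (norm (g x))\<^sup>2)"
    by auto
qed

lemma L2_zero [simp, intro]: "(\<lambda>x. 0) \<in> L2 M"
  by (simp add: L2_def)

lemma L2_scale [simp, intro]:
  assumes "f \<in> L2 M" shows "(\<lambda>x. c * f x) \<in> L2 M"
proof -
  note [measurable] = assms[THEN L2_measurable]
  show ?thesis using L2_square_integrable[OF assms]
    by (simp add: L2_def norm_mult power_mult_distrib)
qed

lemma L2_add [simp, intro]:
  assumes "f \<in> L2 M" "g \<in> L2 M" shows "(\<lambda>x. f x + g x) \<in> L2 M"
proof -
  note [measurable] = assms[THEN L2_measurable]
  have "integrable M (\<lambda>x. (norm (f x + g x))\<^sup>2)"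
  proof (rule Bochner_Integration.integrable_bound)
    show "integrable M (\<lambda>x. 2 * (norm (f x))\<^sup>2 + 2 * (norm (g x))\<^sup>2)"
      using assms[THEN L2_square_integrable] by auto
    have "(norm (f x + g x))\<^sup>2 \<le> 2 * (norm (f x))\<^sup>2 + 2 * (norm (g x))\<^sup>2" for x
    proof -
      have "(norm (f x + g x))\<^sup>2 \<le> (norm (f x) + norm (g x))\<^sup>2"
        by (intro power_mono norm_triangle_ineq) auto
      also have "\<dots> \<le> 2 * (norm (f x))\<^sup>2 + 2 * (norm (g x))\<^sup>2"
        using sum_squares_bound[of "norm (f x)" "norm (g x)"] by (simp add: power2_sum)
      finally show ?thesis .
    qed
    then show "AE x in M. norm ((norm (f x + g x))\<^sup>2) \<le> norm (2 * (norm (f x))\<^sup>2 + 2 * (norm (g x))\<^sup>2)"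
      by auto
  qed measurable
  then show ?thesis by (simp add: L2_def)
qed

lemma L2_diff [simp, intro]:
  assumes "f \<in> L2 M" "g \<in> L2 M" shows "(\<lambda>x. f x - g x) \<in> L2 M"
  using L2_add[OF assms(1) L2_scale[OF assms(2), of "- 1"]] by simp

lemma L2_sum [simp, intro]:
  "(\<And>i. i \<in> I \<Longrightarrow> f i \<in> L2 M) \<Longrightarrow> (\<lambda>x. \<Sum>i\<in>I. f i x) \<in> L2 M"
  by (induction I rule: infinite_finite_induct) auto

lemma L2_inner_add_left:
  "\<lbrakk>f \<in> L2 M; g \<in> L2 M; h \<in> L2 M\<rbrakk> \<Longrightarrow>
     L2_inner M (\<lambda>x. f x + g x) h = L2_inner M f h + L2_inner M g h"
  by (simp add: L2_inner_def distrib_right L2_mult_integrable)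

lemma L2_inner_diff_left:
  "\<lbrakk>f \<in> L2 M; g \<in> L2 M; h \<in> L2 M\<rbrakk> \<Longrightarrow>
     L2_inner M (\<lambda>x. f x - g x) h = L2_inner M f h - L2_inner M g h"
  by (simp add: L2_inner_def left_diff_distrib L2_mult_integrable)

lemma L2_inner_scale_left: "L2_inner M (\<lambda>x. c * f x) h = c * L2_inner M f h"
  by (simp add: L2_inner_def mult.assoc)

lemma L2_inner_zero_left [simp]: "L2_inner M (\<lambda>x. 0) h = 0"
  by (simp add: L2_inner_def)

lemma L2_inner_sum_left:
  "\<lbrakk>\<And>i. i \<in> I \<Longrightarrow> f i \<in> L2 M; h \<in> L2 M\<rbrakk> \<Longrightarrow>
     L2_inner M (\<lambda>x. \<Sum>i\<in>I. f i x) h = (\<Sum>i\<in>I. L2_inner M (f i) h)"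
  by (induction I rule: infinite_finite_induct) (auto simp: L2_inner_add_left)

lemma L2_inner_commute: "L2_inner M f g = cnj (L2_inner M g f)"
  unfolding L2_inner_def Bochner_Integration.integral_cnj[symmetric]
  by (simp add: mult.commute del: Bochner_Integration.integral_cnj)

lemma L2_inner_add_right:
  "\<lbrakk>f \<in> L2 M; g \<in> L2 M; h \<in> L2 M\<rbrakk> \<Longrightarrow>
     L2_inner M h (\<lambda>x. f x + g x) = L2_inner M h f + L2_inner M h g"
  by (subst (1 2 3) L2_inner_commute) (simp add: L2_inner_add_left)

lemma L2_inner_diff_right:
  "\<lbrakk>f \<in> L2 M; g \<in> L2 M; h \<in> L2 M\<rbrakk> \<Longrightarrow>
     L2_inner M h (\<lambda>x. f x - g x) = L2_inner M h f - L2_inner M h g"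
  by (subst (1 2 3) L2_inner_commute) (simp add: L2_inner_diff_left)

lemma L2_inner_scale_right: "L2_inner M h (\<lambda>x. c * f x) = cnj c * L2_inner M h f"
  by (subst (1 2) L2_inner_commute) (simp add: L2_inner_scale_left)

lemma L2_inner_zero_right [simp]: "L2_inner M h (\<lambda>x. 0) = 0"
  by (simp add: L2_inner_def)

lemma L2_inner_sum_right:
  "\<lbrakk>\<And>i. i \<in> I \<Longrightarrow> f i \<in> L2 M; h \<in> L2 M\<rbrakk> \<Longrightarrow>
     L2_inner M h (\<lambda>x. \<Sum>i\<in>I. f i x) = (\<Sum>i\<in>I. L2_inner M h (f i))"
  by (induction I rule: infinite_finite_induct) (auto simp: L2_inner_add_right)

lemma L2_norm_nonneg [simp]: "0 \<le> L2_norm M f"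
  by (simp add: L2_norm_def)

lemma L2_norm_power2: "(L2_norm M f)\<^sup>2 = (\<integral>x. (norm (f x))\<^sup>2 \<partial>M)"
  by (simp add: L2_norm_def)

lemma L2_inner_self: "L2_inner M f f = of_real ((L2_norm M f)\<^sup>2)"
  by (simp add: L2_inner_def L2_norm_power2 complex_norm_square[symmetric]
      flip: integral_complex_of_real of_real_power)

lemma L2_norm_scale: "L2_norm M (\<lambda>x. c * f x) = norm c * L2_norm M f"
  by (simp add: L2_norm_def norm_mult power_mult_distrib real_sqrt_mult)

lemma L2_norm_diff_commute: "L2_norm M (\<lambda>x. f x - g x) = L2_norm M (\<lambda>x. g x - f x)"
  by (simp add: L2_norm_def norm_minus_commute)

lemma L2_norm_zero [simp]: "L2_norm M (\<lambda>x. 0) = 0"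
  by (simp add: L2_norm_def)

lemma L2_norm_add_power2:
  assumes "f \<in> L2 M" "g \<in> L2 M"
  shows "(L2_norm M (\<lambda>x. f x + g x))\<^sup>2 =
           (L2_norm M f)\<^sup>2 + (L2_norm M g)\<^sup>2 + 2 * Re (L2_inner M f g)"
proof -
  have "complex_of_real ((L2_norm M (\<lambda>x. f x + g x))\<^sup>2) =
      of_real ((L2_norm M f)\<^sup>2) + of_real ((L2_norm M g)\<^sup>2) +
      (L2_inner M f g + cnj (L2_inner M f g))"
    unfolding L2_inner_self[symmetric] L2_inner_commute[of M g f, symmetric] using assms
    by (simp add: L2_inner_add_left L2_inner_add_right)
  also have "\<dots> = of_real ((L2_norm M f)\<^sup>2 + (L2_norm M g)\<^sup>2 + 2 * Re (L2_inner M f g))"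
    by (simp add: complex_add_cnj)
  finally show ?thesis by (simp only: of_real_eq_iff)
qed

text \<open>
  Expanding the norm of \<open>f - t \<langle>f, g\<rangle> g\<close> with the real parameter \<open>t\<close> avoids dividing by the
  norm of \<open>g\<close> before it is known to be positive.
\<close>

lemma L2_Cauchy_Schwarz:
  assumes "f \<in> L2 M" "g \<in> L2 M"
  shows "norm (L2_inner M f g) \<le> L2_norm M f * L2_norm M g"
proof -
  define a where "a = L2_inner M f g"
  have *: "0 \<le> (L2_norm M f)\<^sup>2 + t\<^sup>2 * (norm a)\<^sup>2 * (L2_norm M g)\<^sup>2 - 2 * t * (norm a)\<^sup>2" for t :: real
  proof -
    have "Re (L2_inner M f (\<lambda>x. (- (of_real t * a)) * g x)) = - t * (norm a)\<^sup>2"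
      unfolding L2_inner_scale_right a_def[symmetric] cmod_power2
      by (simp add: algebra_simps power2_eq_square)
    moreover have "L2_norm M (\<lambda>x. (- (of_real t * a)) * g x) = \<bar>t\<bar> * norm a * L2_norm M g"
      unfolding L2_norm_scale by (simp add: norm_mult)
    ultimately have "(L2_norm M (\<lambda>x. f x + (- (of_real t * a)) * g x))\<^sup>2 =
        (L2_norm M f)\<^sup>2 + (\<bar>t\<bar> * norm a * L2_norm M g)\<^sup>2 + 2 * (- t * (norm a)\<^sup>2)"
      using assms L2_scale[OF assms(2), of "- (of_real t * a)"]
      by (subst L2_norm_add_power2) auto
    then have "(L2_norm M f)\<^sup>2 + (\<bar>t\<bar> * norm a * L2_norm M g)\<^sup>2 + 2 * (- t * (norm a)\<^sup>2) \<ge> 0"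
      by (metis zero_le_power2)
    then show ?thesis by (simp add: power_mult_distrib)
  qed
  have "(norm a)\<^sup>2 \<le> (L2_norm M f)\<^sup>2 * (L2_norm M g)\<^sup>2"
  proof (cases "L2_norm M g = 0")
    case True
    have "norm a = 0"
    proof (rule ccontr)
      assume "norm a \<noteq> 0"
      with *[of "((L2_norm M f)\<^sup>2 + 1) / (2 * (norm a)\<^sup>2)"] True show False by simp
    qed
    then show ?thesis by simp
  next
    case False
    define t where "t = 1 / (L2_norm M g)\<^sup>2"
    have "t\<^sup>2 * (norm a)\<^sup>2 * (L2_norm M g)\<^sup>2 = t * (norm a)\<^sup>2"
      using False by (simp add: t_def power2_eq_square)
    with *[of t] have "(norm a)\<^sup>2 / (L2_norm M g)\<^sup>2 \<le> (L2_norm M f)\<^sup>2"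
      by (simp add: t_def)
    with False show ?thesis by (simp add: divide_le_eq)
  qed
  then show ?thesis unfolding a_def
    by (simp flip: power_mult_distrib)
qed

lemma L2_inner_null_left:
  "\<lbrakk>f \<in> L2 M; g \<in> L2 M; L2_norm M f = 0\<rbrakk> \<Longrightarrow> L2_inner M f g = 0"
  using L2_Cauchy_Schwarz[of f M g] by simp

lemma L2_norm_triangle:
  assumes "f \<in> L2 M" "g \<in> L2 M"
  shows "L2_norm M (\<lambda>x. f x + g x) \<le> L2_norm M f + L2_norm M g"
proof (rule power2_le_imp_le)
  have "Re (L2_inner M f g) \<le> L2_norm M f * L2_norm M g"
    using L2_Cauchy_Schwarz[OF assms] complex_Re_le_cmod[of "L2_inner M f g"] by linarith
  then show "(L2_norm M (\<lambda>x. f x + g x))\<^sup>2 \<le> (L2_norm M f + L2_norm M g)\<^sup>2"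
    using assms by (simp add: L2_norm_add_power2 power2_sum)
qed simp

lemma L2_norm_triangle_diff:
  assumes "f \<in> L2 M" "g \<in> L2 M" "h \<in> L2 M"
  shows "L2_norm M (\<lambda>x. f x - h x) \<le> L2_norm M (\<lambda>x. f x - g x) + L2_norm M (\<lambda>x. g x - h x)"
  using L2_norm_triangle[OF L2_diff[OF assms(1,2)] L2_diff[OF assms(2,3)]] by simp

lemma L2_inner_cong_null:
  assumes "f \<in> L2 M" "g \<in> L2 M" "h \<in> L2 M" "L2_norm M (\<lambda>x. f x - g x) = 0"
  shows "L2_inner M f h = L2_inner M g h"
  using L2_inner_null_left[OF L2_diff[OF assms(1,2)] assms(3,4)] assms
  by (simp add: L2_inner_diff_left)

lemma L2_norm_eq_0_iff_AE:
  assumes "f \<in> L2 M"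
  shows "L2_norm M f = 0 \<longleftrightarrow> (AE x in M. f x = 0)"
  using integral_nonneg_eq_0_iff_AE[OF L2_square_integrable[OF assms]]
  by (simp add: L2_norm_def)

lemma L2_norm_sum_orthogonal:
  assumes "finite I" "\<And>i. i \<in> I \<Longrightarrow> v i \<in> L2 M"
    and "\<And>i j. \<lbrakk>i \<in> I; j \<in> I; i \<noteq> j\<rbrakk> \<Longrightarrow> L2_inner M (v i) (v j) = 0"
  shows "(L2_norm M (\<lambda>x. \<Sum>i\<in>I. v i x))\<^sup>2 = (\<Sum>i\<in>I. (L2_norm M (v i))\<^sup>2)"
  using assms
proof (induction I rule: finite_induct)
  case (insert i I)
  have "L2_inner M (v i) (\<lambda>x. \<Sum>j\<in>I. v j x) = (\<Sum>j\<in>I. L2_inner M (v i) (v j))"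
    by (rule L2_inner_sum_right) (auto intro: insert.prems)
  also have "\<dots> = 0" using insert.hyps insert.prems by (intro sum.neutral) auto
  finally show ?case using insert by (simp add: L2_norm_add_power2)
qed simp

subsection \<open>Convergence\<close>

lemma L2_inner_tendsto:
  assumes u: "\<And>n. u n \<in> L2 M" and "f \<in> L2 M" "g \<in> L2 M"
    and lim: "(\<lambda>n. L2_norm M (\<lambda>x. u n x - f x)) \<longlonglongrightarrow> 0"
  shows "(\<lambda>n. L2_inner M (u n) g) \<longlonglongrightarrow> L2_inner M f g"
proof -
  have "(\<lambda>n. L2_inner M (u n) g - L2_inner M f g) \<longlonglongrightarrow> 0"
  proof (rule Lim_null_comparison)
    show "\<forall>\<^sub>F n in sequentially. norm (L2_inner M (u n) g - L2_inner M f g)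
            \<le> L2_norm M (\<lambda>x. u n x - f x) * L2_norm M g"
      using assms L2_Cauchy_Schwarz[OF L2_diff[OF u assms(2)] assms(3)]
      by (simp add: L2_inner_diff_left)
    show "(\<lambda>n. L2_norm M (\<lambda>x. u n x - f x) * L2_norm M g) \<longlonglongrightarrow> 0"
      using tendsto_mult_right[OF lim] by simp
  qed
  then show ?thesis by (simp add: LIM_zero_iff)
qed

lemma L2_sums_inner:
  assumes "L2_sums M v f" "g \<in> L2 M"
  shows "(\<lambda>n. L2_inner M (v n) g) sums L2_inner M f g"
  unfolding sums_def using assms
  by (simp add: L2_inner_sum_left[symmetric] L2_sums_def L2_inner_tendsto)

lemma L2_norm_tendsto:
  assumes u: "\<And>n. u n \<in> L2 M" and f: "f \<in> L2 M"
    and lim: "(\<lambda>n. L2_norm M (\<lambda>x. u n x - f x)) \<longlonglongrightarrow> 0"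
  shows "(\<lambda>n. L2_norm M (u n)) \<longlonglongrightarrow> L2_norm M f"
proof -
  have "\<bar>L2_norm M (u n) - L2_norm M f\<bar> \<le> L2_norm M (\<lambda>x. u n x - f x)" for n
    using L2_norm_triangle_diff[OF u[of n] f L2_zero] L2_norm_triangle_diff[OF f u[of n] L2_zero]
    by (simp add: L2_norm_diff_commute[of M f "u n"])
  then have "(\<lambda>n. L2_norm M (u n) - L2_norm M f) \<longlonglongrightarrow> 0"
    by (intro Lim_null_comparison[OF _ lim]) auto
  then show ?thesis by (simp add: LIM_zero_iff)
qed

subsection \<open>Completeness\<close>

lemma (in prob_space) L1_norm_le_L2_norm:
  assumes "g \<in> L2 M"
  shows "integrable M g" and "(\<integral>x. norm (g x) \<partial>M) \<le> L2_norm M g"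
proof -
  note [measurable] = L2_measurable[OF assms]
  have one: "(\<lambda>x. 1) \<in> L2 M" by (simp add: L2_def)
  have "integrable M (\<lambda>x. g x * cnj 1)" by (rule L2_mult_integrable[OF assms one])
  then show int: "integrable M g" by simp
  have g': "(\<lambda>x. complex_of_real (norm (g x))) \<in> L2 M"
    using L2_square_integrable[OF assms] by (simp add: L2_def)
  have "L2_norm M (\<lambda>x. 1) = 1" by (simp add: L2_norm_def prob_space)
  moreover have "L2_norm M (\<lambda>x. complex_of_real (norm (g x))) = L2_norm M g"
    by (simp add: L2_norm_def)
  moreover have "L2_inner M (\<lambda>x. complex_of_real (norm (g x))) (\<lambda>x. 1) = of_real (\<integral>x. norm (g x) \<partial>M)"
    by (simp add: L2_inner_def)
  ultimately show "(\<integral>x. norm (g x) \<partial>M) \<le> L2_norm M g"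
    using L2_Cauchy_Schwarz[OF g' one] by simp
qed

lemma L2_norm_le_nn_integral:
  assumes [measurable]: "g \<in> borel_measurable M" and c: "0 \<le> c"
    and le: "(\<integral>\<^sup>+x. ennreal ((norm (g x))\<^sup>2) \<partial>M) \<le> ennreal (c\<^sup>2)"
  shows "g \<in> L2 M" and "L2_norm M g \<le> c"
proof -
  have int: "integrable M (\<lambda>x. (norm (g x))\<^sup>2)"
    using le by (intro integrableI_nonneg) (auto simp: le_less_trans[OF le])
  then show "g \<in> L2 M" by (simp add: L2_def)
  have "(L2_norm M g)\<^sup>2 \<le> c\<^sup>2"
    using le unfolding L2_norm_power2 nn_integral_eq_integral[OF int AE_I2[OF zero_le_power2]]
    by simp
  then show "L2_norm M g \<le> c" using c by (rule power2_le_imp_le)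
qed

text \<open>
  The Riesz--Fischer theorem. Along a subsequence whose increments have norm at most \<open>(1/2)^k\<close> the
  increments are absolutely summable almost everywhere, because on a probability space the
  \<open>L\<^sup>1\<close>-norm is at most the \<open>L\<^sup>2\<close>-norm. The pointwise limit is the limit in norm by Fatou's lemma.
\<close>

lemma (in prob_space) L2_complete:
  assumes u: "\<And>n. u n \<in> L2 M"
    and Cauchy: "\<And>\<epsilon>. \<epsilon> > 0 \<Longrightarrow> \<exists>N. \<forall>n\<ge>N. \<forall>m\<ge>n. L2_norm M (\<lambda>x. u m x - u n x) < \<epsilon>"
  shows "\<exists>f\<in>L2 M. (\<lambda>n. L2_norm M (\<lambda>x. u n x - f x)) \<longlonglongrightarrow> 0"
proof -
  note [measurable] = u[THEN L2_measurable]
  have "\<forall>k. \<exists>N. \<forall>n\<ge>N. \<forall>m\<ge>n. L2_norm M (\<lambda>x. u m x - u n x) < (1/2)^k"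
    using Cauchy by simp
  then obtain N where N0: "\<And>k n m. \<lbrakk>n \<ge> N k; m \<ge> n\<rbrakk> \<Longrightarrow> L2_norm M (\<lambda>x. u m x - u n x) < (1/2)^k"
    by metis
  have N: "L2_norm M (\<lambda>x. u m x - u n x) < (1/2)^k" if "n \<ge> N k" "m \<ge> N k" for k n m
    using N0[of k n m] N0[of k m n] that L2_norm_diff_commute[of M "u m" "u n"] by (cases "m \<ge> n") auto
  \<comment> \<open>The sum dominates every \<open>N j\<close> with \<open>j \<le> k\<close>, so a single bound serves all later indices.\<close>
  define r where "r k = (\<Sum>j\<le>k. N j)" for k
  have r_ge: "N k \<le> r j" if "k \<le> j" for j k
    using that member_le_sum[of k "{..j}" N] by (simp add: r_def)
  define w where "w k = u (r k)" for k
  have w [measurable]: "w k \<in> borel_measurable M" and w_L2: "w k \<in> L2 M" for k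
    using u by (auto simp: w_def)
  have "(\<integral>\<^sup>+x. (\<Sum>k. ennreal (norm (w (Suc k) x - w k x))) \<partial>M) =
      (\<Sum>k. \<integral>\<^sup>+x. ennreal (norm (w (Suc k) x - w k x)) \<partial>M)"
    by (rule nn_integral_suminf) measurable
  also have "\<dots> \<le> (\<Sum>k. ennreal ((1/2)^k))"
  proof (rule suminf_le)
    fix k
    have L2: "(\<lambda>x. w (Suc k) x - w k x) \<in> L2 M" using w_L2 by auto
    have "(\<integral>\<^sup>+x. ennreal (norm (w (Suc k) x - w k x)) \<partial>M) = ennreal (\<integral>x. norm (w (Suc k) x - w k x) \<partial>M)"
      using L1_norm_le_L2_norm(1)[OF L2] by (intro nn_integral_eq_integral) auto
    also have "\<dots> \<le> ennreal ((1/2)^k)"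
      using L1_norm_le_L2_norm(2)[OF L2] N[of k "r k" "r (Suc k)"] r_ge
      by (intro ennreal_leI) (simp add: w_def)
    finally show "(\<integral>\<^sup>+x. ennreal (norm (w (Suc k) x - w k x)) \<partial>M) \<le> ennreal ((1/2)^k)" .
  qed auto
  also have "\<dots> = ennreal (\<Sum>k. (1/2)^k)"
    by (intro suminf_ennreal2) (auto simp: summable_geometric)
  finally have fin: "(\<integral>\<^sup>+x. (\<Sum>k. ennreal (norm (w (Suc k) x - w k x))) \<partial>M) \<noteq> \<infinity>"
    by (auto simp: top_unique)
  have "AE x in M. (\<Sum>k. ennreal (norm (w (Suc k) x - w k x))) \<noteq> \<infinity>"
    by (rule nn_integral_noteq_infinite[OF _ fin]) measurable
  then have conv: "AE x in M. convergent (\<lambda>k. w k x)"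
  proof eventually_elim
    case (elim x)
    then have "summable (\<lambda>k. norm (w (Suc k) x - w k x))"
      by (intro summable_suminf_not_top) auto
    then have "summable (\<lambda>k. w (Suc k) x - w k x)" by (rule summable_norm_cancel)
    then have "convergent (\<lambda>n. w n x - w 0 x)"
      by (simp add: summable_iff_convergent sum_lessThan_telescope[of "\<lambda>k. w k x"])
    then show ?case by (simp add: convergent_diff_const_right_iff)
  qed
  define f where "f x = lim (\<lambda>k. w k x)" for x
  have f [measurable]: "f \<in> borel_measurable M"
    unfolding f_def by measurable
  have conv': "AE x in M. (\<lambda>k. w k x) \<longlonglongrightarrow> f x"
    using conv by eventually_elim (simp add: f_def convergent_LIMSEQ_iff)
  have bound: "(\<lambda>x. u n x - f x) \<in> L2 M \<and> L2_norm M (\<lambda>x. u n x - f x) \<le> (1/2)^k" if n: "n \<ge> N k" for n k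
  proof -
    have "(\<integral>\<^sup>+x. ennreal ((norm (u n x - f x))\<^sup>2) \<partial>M) =
        (\<integral>\<^sup>+x. liminf (\<lambda>j. ennreal ((norm (u n x - w j x))\<^sup>2)) \<partial>M)"
    proof (rule nn_integral_cong_AE, use conv' in eventually_elim)
      case (elim x)
      then have "(\<lambda>j. ennreal ((norm (u n x - w j x))\<^sup>2)) \<longlonglongrightarrow> ennreal ((norm (u n x - f x))\<^sup>2)"
        by (intro tendsto_intros)
      then show ?case by (rule lim_imp_Liminf[OF sequentially_bot, symmetric])
    qed
    also have "\<dots> \<le> liminf (\<lambda>j. \<integral>\<^sup>+x. ennreal ((norm (u n x - w j x))\<^sup>2) \<partial>M)"
      by (rule nn_integral_liminf) measurable
    also have "\<dots> \<le> limsup (\<lambda>j. \<integral>\<^sup>+x. ennreal ((norm (u n x - w j x))\<^sup>2) \<partial>M)"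
      by (rule Liminf_le_Limsup) simp
    also have "\<dots> \<le> ennreal (((1/2)^k)\<^sup>2)"
    proof (rule Limsup_bounded, rule eventually_sequentiallyI)
      fix j assume "k \<le> j"
      then have "L2_norm M (\<lambda>x. u n x - w j x) \<le> (1/2)^k"
        using N[OF r_ge n] by (auto simp: w_def intro: less_imp_le)
      then have "(L2_norm M (\<lambda>x. u n x - w j x))\<^sup>2 \<le> ((1/2)^k)\<^sup>2"
        by (rule power_mono) simp
      then show "(\<integral>\<^sup>+x. ennreal ((norm (u n x - w j x))\<^sup>2) \<partial>M) \<le> ennreal (((1/2)^k)\<^sup>2)"
        unfolding L2_norm_power2
        by (subst nn_integral_eq_integral)
           (auto intro!: L2_square_integrable ennreal_leI u w_L2)
    qed
    finally show ?thesis
      using L2_norm_le_nn_integral[of "\<lambda>x. u n x - f x" M "(1/2)^k"] by simp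
  qed
  have "(\<lambda>x. u (N 0) x - f x) \<in> L2 M" using bound[OF order_refl] by blast
  from L2_diff[OF u[of "N 0"] this] have "f \<in> L2 M" by simp
  moreover have "(\<lambda>n. L2_norm M (\<lambda>x. u n x - f x)) \<longlonglongrightarrow> 0"
  proof (rule LIMSEQ_I)
    fix \<epsilon> :: real assume "\<epsilon> > 0"
    then obtain k where "(1/2)^k < \<epsilon>" using real_arch_pow_inv[of \<epsilon> "1/2"] by auto
    then show "\<exists>no. \<forall>n\<ge>no. norm (L2_norm M (\<lambda>x. u n x - f x) - 0) < \<epsilon>"
      using bound[of k] by (intro exI[of _ "N k"]) (auto intro: le_less_trans)
  qed
  ultimately show ?thesis by blast
qed

text \<open>
  By Pythagoras, the squared distance of two partial sums is a section of a convergent series of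
  real numbers.
\<close>

lemma (in prob_space) L2_orthogonal_series:
  assumes v: "\<And>n. v n \<in> L2 M" and orth: "\<And>m n. m \<noteq> n \<Longrightarrow> L2_inner M (v m) (v n) = 0"
    and summable: "summable (\<lambda>n. (L2_norm M (v n))\<^sup>2)"
  shows "\<exists>f. L2_sums M v f"
proof -
  have "\<exists>f\<in>L2 M. (\<lambda>N. L2_norm M (\<lambda>x. (\<Sum>n<N. v n x) - f x)) \<longlonglongrightarrow> 0"
  proof (rule L2_complete)
    fix \<epsilon> :: real assume "\<epsilon> > 0"
    with summable obtain N where N: "\<And>n m. n \<ge> N \<Longrightarrow> norm (\<Sum>k=n..<m. (L2_norm M (v k))\<^sup>2) < \<epsilon>\<^sup>2"
      unfolding summable_Cauchy by (meson zero_less_power)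
    have "L2_norm M (\<lambda>x. (\<Sum>k<m. v k x) - (\<Sum>k<n. v k x)) < \<epsilon>" if "n \<ge> N" "m \<ge> n" for n m
    proof (rule power2_less_imp_less)
      have "(\<lambda>x. (\<Sum>k<m. v k x) - (\<Sum>k<n. v k x)) = (\<lambda>x. \<Sum>k=n..<m. v k x)"
        using that by (simp add: lessThan_atLeast0 sum_diff_nat_ivl)
      then have "(L2_norm M (\<lambda>x. (\<Sum>k<m. v k x) - (\<Sum>k<n. v k x)))\<^sup>2 = (\<Sum>k=n..<m. (L2_norm M (v k))\<^sup>2)"
        using v orth by (simp add: L2_norm_sum_orthogonal)
      also have "\<dots> < \<epsilon>\<^sup>2" using N[OF that(1), of m] by simp
      finally show "(L2_norm M (\<lambda>x. (\<Sum>k<m. v k x) - (\<Sum>k<n. v k x)))\<^sup>2 < \<epsilon>\<^sup>2" .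
    qed (use \<open>\<epsilon> > 0\<close> in simp)
    then show "\<exists>N. \<forall>n\<ge>N. \<forall>m\<ge>n. L2_norm M (\<lambda>x. (\<Sum>k<m. v k x) - (\<Sum>k<n. v k x)) < \<epsilon>" by blast
  qed (use v in auto)
  then show ?thesis using v by (auto simp: L2_sums_def)
qed

subsection \<open>Orthonormal families\<close>

definition L2_orthonormal :: "'b measure \<Rightarrow> 'i set \<Rightarrow> ('i \<Rightarrow> 'b \<Rightarrow> complex) \<Rightarrow> bool" where
  "L2_orthonormal M I u \<longleftrightarrow> (\<forall>i\<in>I. u i \<in> L2 M) \<and>
     (\<forall>i\<in>I. \<forall>j\<in>I. L2_inner M (u i) (u j) = of_bool (i = j))"

definition L2_proj :: "'b measure \<Rightarrow> 'i set \<Rightarrow> ('i \<Rightarrow> 'b \<Rightarrow> complex) \<Rightarrow> ('b \<Rightarrow> complex) \<Rightarrow> 'b \<Rightarrow> complex" where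
  "L2_proj M I u f = (\<lambda>x. \<Sum>i\<in>I. L2_inner M f (u i) * u i x)"

lemma L2_orthonormalD:
  assumes "L2_orthonormal M I u"
  shows "i \<in> I \<Longrightarrow> u i \<in> L2 M"
    and "\<lbrakk>i \<in> I; j \<in> I\<rbrakk> \<Longrightarrow> L2_inner M (u i) (u j) = of_bool (i = j)"
  using assms by (auto simp: L2_orthonormal_def)

lemma L2_orthonormal_norm:
  assumes "L2_orthonormal M I u" "i \<in> I" shows "L2_norm M (u i) = 1"
proof -
  have "complex_of_real ((L2_norm M (u i))\<^sup>2) = of_real 1"
    using L2_inner_self[of M "u i"] L2_orthonormalD(2)[OF assms(1,2,2)] by simp
  then have "(L2_norm M (u i))\<^sup>2 = 1" by (simp only: of_real_eq_iff)
  then show ?thesis using L2_norm_nonneg[of M "u i"] by (auto simp: power2_eq_1_iff)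
qed

lemma L2_orthonormal_subset: "\<lbrakk>L2_orthonormal M I u; J \<subseteq> I\<rbrakk> \<Longrightarrow> L2_orthonormal M J u"
  by (auto simp: L2_orthonormal_def subset_iff)

lemma L2_proj_in_L2: "L2_orthonormal M I u \<Longrightarrow> L2_proj M I u f \<in> L2 M"
  by (auto simp: L2_proj_def L2_orthonormal_def)

lemma L2_inner_combination:
  assumes "L2_orthonormal M I u" "finite I" "j \<in> I"
  shows "L2_inner M (\<lambda>x. \<Sum>i\<in>I. c i * u i x) (u j) = c j"
proof -
  have "L2_inner M (\<lambda>x. \<Sum>i\<in>I. c i * u i x) (u j) = (\<Sum>i\<in>I. c i * of_bool (i = j))"
    using assms by (subst L2_inner_sum_left) (auto simp: L2_inner_scale_left L2_orthonormalD)
  also have "\<dots> = c j" using assms by (simp add: of_bool_def if_distrib[of "(*) _"] cong: if_cong)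
  finally show ?thesis .
qed

lemma L2_inner_residual:
  assumes "L2_orthonormal M I u" "finite I" "f \<in> L2 M" "j \<in> I"
  shows "L2_inner M (\<lambda>x. f x - L2_proj M I u f x) (u j) = 0"
  using assms L2_inner_combination[of M I u j "\<lambda>i. L2_inner M f (u i)"]
  by (subst L2_inner_diff_left)
     (auto simp: L2_proj_in_L2 L2_orthonormalD, simp add: L2_proj_def)

lemma L2_norm_combination:
  assumes "L2_orthonormal M I u" "finite I"
  shows "(L2_norm M (\<lambda>x. \<Sum>i\<in>I. c i * u i x))\<^sup>2 = (\<Sum>i\<in>I. (norm (c i))\<^sup>2)"
proof -
  show ?thesis using assms
    by (subst L2_norm_sum_orthogonal)
       (auto simp: L2_orthonormal_norm L2_orthonormalD L2_inner_scale_left L2_inner_scale_right L2_norm_scale power_mult_distrib)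
qed

lemma L2_norm_proj:
  assumes "L2_orthonormal M I u" "finite I"
  shows "(L2_norm M (L2_proj M I u f))\<^sup>2 = (\<Sum>i\<in>I. (norm (L2_inner M f (u i)))\<^sup>2)"
  unfolding L2_proj_def by (rule L2_norm_combination[OF assms])

text \<open>
  The projection of \<open>f\<close> is orthogonal to the residual, so its norm is at most that of \<open>f\<close>.
\<close>

lemma L2_Bessel:
  assumes "L2_orthonormal M I u" "finite I" "f \<in> L2 M"
  shows "(\<Sum>i\<in>I. (norm (L2_inner M f (u i)))\<^sup>2) \<le> (L2_norm M f)\<^sup>2"
proof -
  let ?p = "L2_proj M I u f" and ?r = "\<lambda>x. f x - L2_proj M I u f x"
  note p = L2_proj_in_L2[OF assms(1), of f]
  have "L2_inner M ?r ?p = (\<Sum>i\<in>I. cnj (L2_inner M f (u i)) * L2_inner M ?r (u i))"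
    using assms p unfolding L2_proj_def[of M I u f]
    by (subst L2_inner_sum_right) (auto simp: L2_inner_scale_right L2_orthonormalD)
  also have "\<dots> = 0" using assms by (simp add: L2_inner_residual)
  finally have "(L2_norm M (\<lambda>x. ?r x + ?p x))\<^sup>2 = (L2_norm M ?r)\<^sup>2 + (L2_norm M ?p)\<^sup>2"
    using assms p by (subst L2_norm_add_power2) auto
  then show ?thesis using assms by (simp add: L2_norm_proj)
qed

subsection \<open>Orthonormal bases\<close>

lemma L2_orthonormal_basis_orthonormal:
  assumes "L2_orthonormal_basis M E" shows "L2_orthonormal M E (\<lambda>e. e)"
  using assms by (auto simp: L2_orthonormal_basis_def L2_orthonormal_def L2_inner_self)

text \<open>
  A maximal orthonormal set exists by Zorn's lemma. A vector of non-zero norm orthogonal to it could be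
  normalised and added.
\<close>

lemma L2_orthonormal_basis_exists: "\<exists>E. L2_orthonormal_basis M E"
proof -
  define \<E> where "\<E> = {E. L2_orthonormal M E (\<lambda>e. e)}"
  have "\<exists>E\<in>\<E>. \<forall>F\<in>\<E>. E \<subseteq> F \<longrightarrow> F = E"
  proof (rule subset_Zorn')
    fix C assume C: "subset.chain \<E> C"
    have "L2_inner M e e' = of_bool (e = e')" if "e \<in> \<Union>C" "e' \<in> \<Union>C" for e e'
    proof -
      from that C obtain F where "F \<in> C" "e \<in> F" "e' \<in> F"
        by (auto simp: subset_chain_def) (metis subsetD)
      with C show ?thesis by (auto simp: subset_chain_def \<E>_def L2_orthonormal_def)
    qed
    then show "\<Union>C \<in> \<E>" using C by (auto simp: \<E>_def L2_orthonormal_def subset_chain_def)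
  qed
  then obtain E where E: "L2_orthonormal M E (\<lambda>e. e)"
    and max: "\<And>F. \<lbrakk>L2_orthonormal M F (\<lambda>e. e); E \<subseteq> F\<rbrakk> \<Longrightarrow> F = E"
    unfolding \<E>_def by blast
  have "L2_norm M f = 0" if f: "f \<in> L2_orthogonal M E" for f
  proof (rule ccontr)
    assume nz: "L2_norm M f \<noteq> 0"
    define h where "h = (\<lambda>x. of_real (1 / L2_norm M f) * f x)"
    have fL2: "f \<in> L2 M" and fE: "\<And>e. e \<in> E \<Longrightarrow> L2_inner M f e = 0"
      using f by (auto simp: L2_orthogonal_def)
    have fE': "L2_inner M e f = 0" if "e \<in> E" for e
      using fE[OF that] L2_inner_commute[of M e f] by simp
    have h: "h \<in> L2 M" using fL2 unfolding h_def by (rule L2_scale)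
    have hh: "L2_inner M h h = 1"
    proof -
      have "L2_norm M h = 1" unfolding h_def L2_norm_scale using nz by (simp add: norm_divide)
      then show ?thesis by (simp add: L2_inner_self)
    qed
    have hE: "L2_inner M h e = 0" "L2_inner M e h = 0" if "e \<in> E" for e
      unfolding h_def L2_inner_scale_left L2_inner_scale_right using fE[OF that] fE'[OF that] by simp_all
    have "L2_orthonormal M (insert h E) (\<lambda>e. e)"
      using E h hh hE unfolding L2_orthonormal_def by (auto simp: of_bool_def)
    then have "h \<in> E" using max[of "insert h E"] by auto
    then show False using hE hh by simp
  qed
  then have "L2_orthonormal_basis M E"
    using E L2_orthonormal_norm[OF E]
    by (auto simp: L2_orthonormal_basis_def L2_orthonormal_def)
  then show ?thesis ..
qed

text \<open>
  The definition of an orthonormal basis only says that its orthogonal complement is null.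
  Let \<open>F k\<close> be finite subsets of \<open>E\<close> along which the squared coefficients of \<open>f\<close> exhaust their sum \<open>S\<close>. The
  projections \<open>p k\<close> to their spans form a Cauchy sequence. The difference of \<open>f\<close> and
  the limit \<open>g\<close> is orthogonal to \<open>E\<close>, hence null, and the norm of \<open>g\<close> squared is \<open>S\<close>.
\<close>

lemma (in prob_space) L2_Parseval:
  assumes E: "L2_orthonormal_basis M E" and f: "f \<in> L2 M"
  shows "((\<lambda>e. (norm (L2_inner M f e))\<^sup>2) has_sum (L2_norm M f)\<^sup>2) E"
proof -
  define q where "q e = (norm (L2_inner M f e))\<^sup>2" for e
  have q_nonneg: "q e \<ge> 0" for e by (simp add: q_def)
  note on = L2_orthonormal_basis_orthonormal[OF E]
  have onF: "L2_orthonormal M F (\<lambda>e. e)" if "F \<subseteq> E" for F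
    using on that by (rule L2_orthonormal_subset)
  have Bessel: "sum q F \<le> (L2_norm M f)\<^sup>2" if "finite F" "F \<subseteq> E" for F
    using L2_Bessel[OF onF[OF that(2)] that(1) f] by (simp add: q_def)
  have "q summable_on E"
    by (rule nonneg_bdd_above_summable_on) (auto simp: q_nonneg intro!: bdd_aboveI2[where M = "(L2_norm M f)\<^sup>2"] Bessel)
  then obtain S where S: "(q has_sum S) E" by (auto simp: summable_on_def)
  have le_S: "sum q F \<le> S" if "finite F" "F \<subseteq> E" for F
    using has_sum_mono2[OF has_sum_finite[OF that(1)] S that(2)] q_nonneg by auto
  have "\<exists>F. finite F \<and> F \<subseteq> E \<and> S - sum q F \<le> inverse (Suc k)" for k :: nat
    using has_sum_finite_approximation[OF S, of "inverse (Suc k)"] by (force simp: dist_real_def)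
  then obtain F0 where F0: "\<And>k::nat. finite (F0 k)" "\<And>k. F0 k \<subseteq> E" "\<And>k. S - sum q (F0 k) \<le> inverse (Suc k)"
    by metis
  define F where "F k = (\<Union>j\<le>k. F0 j)" for k
  have F: "finite (F k)" "F k \<subseteq> E" for k using F0 by (auto simp: F_def)
  have F_mono: "F k \<subseteq> F m" if "k \<le> m" for k m using that by (force simp: F_def)
  have F_S: "S - sum q (F k) \<le> inverse (Suc k)" for k
    using F0(3)[of k] sum_mono2[of "F k" "F0 k" q] F(1) q_nonneg by (force simp: F_def)
  define p where "p k = L2_proj M (F k) (\<lambda>e. e) f" for k
  have p: "p k \<in> L2 M" for k unfolding p_def by (rule L2_proj_in_L2[OF onF[OF F(2)]])
  have p_norm: "(L2_norm M (p k))\<^sup>2 = sum q (F k)" for k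
    unfolding p_def q_def by (rule L2_norm_proj[OF onF[OF F(2)] F(1)])
  have "\<exists>g\<in>L2 M. (\<lambda>n. L2_norm M (\<lambda>x. p n x - g x)) \<longlonglongrightarrow> 0"
  proof (rule L2_complete[OF p])
    fix \<epsilon> :: real assume "\<epsilon> > 0"
    then obtain N :: nat where N: "inverse (Suc N) < \<epsilon>\<^sup>2"
      using reals_Archimedean[of "\<epsilon>\<^sup>2"] by auto
    have "L2_norm M (\<lambda>x. p m x - p n x) < \<epsilon>" if "n \<ge> N" "m \<ge> n" for n m
    proof (rule power2_less_imp_less)
      have "(\<lambda>x. p m x - p n x) = (\<lambda>x. \<Sum>e\<in>F m - F n. L2_inner M f e * e x)"
        using F(1) F_mono[OF that(2)] by (simp add: p_def L2_proj_def sum_diff)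
      then have "(L2_norm M (\<lambda>x. p m x - p n x))\<^sup>2 = sum q (F m - F n)"
        using L2_norm_combination[OF onF, of "F m - F n" "L2_inner M f"] F by (auto simp: q_def)
      also have "\<dots> = sum q (F m) - sum q (F n)"
        using F(1) F_mono[OF that(2)] by (simp add: sum_diff)
      also have "\<dots> \<le> inverse (Suc n)" using le_S[OF F, of m] F_S[of n] by simp
      also have "\<dots> \<le> inverse (Suc N)" using that by (simp add: divide_simps)
      finally show "(L2_norm M (\<lambda>x. p m x - p n x))\<^sup>2 < \<epsilon>\<^sup>2" using N by simp
    qed (use \<open>\<epsilon> > 0\<close> in simp)
    then show "\<exists>N. \<forall>n\<ge>N. \<forall>m\<ge>n. L2_norm M (\<lambda>x. p m x - p n x) < \<epsilon>" by blast
  qed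
  then obtain g where g: "g \<in> L2 M" "(\<lambda>n. L2_norm M (\<lambda>x. p n x - g x)) \<longlonglongrightarrow> 0" by blast
  have inv0: "(\<lambda>k. inverse (real (Suc k))) \<longlonglongrightarrow> 0" by (rule LIMSEQ_inverse_real_of_nat)
  have "L2_inner M (\<lambda>x. f x - g x) e = 0" if e: "e \<in> E" for e
  proof -
    have eL2: "e \<in> L2 M" using L2_orthonormalD(1)[OF on e] .
    \<comment> \<open>Either \<open>e\<close> is already used by \<open>p k\<close>, or adding it to \<open>F k\<close> raises the sum by
    the squared coefficient at \<open>e\<close>, for which at most \<open>S - sum q (F k)\<close> is left.\<close>
    have "(norm (L2_inner M f e - L2_inner M (p k) e))\<^sup>2 \<le> inverse (Suc k)" for k
    proof (cases "e \<in> F k")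
      case True
      have "L2_inner M (p k) e = L2_inner M f e"
        unfolding p_def L2_proj_def
        by (rule L2_inner_combination[OF onF[OF F(2)] F(1) True])
      then show ?thesis by simp
    next
      case False
      have "L2_inner M (p k) e = (\<Sum>e'\<in>F k. L2_inner M f e' * L2_inner M e' e)"
        unfolding p_def L2_proj_def using F(2)[of k] L2_orthonormalD(1)[OF on] eL2
        by (subst L2_inner_sum_left) (auto simp: L2_inner_scale_left intro!: L2_scale)
      also have "\<dots> = 0"
      proof (intro sum.neutral ballI)
        fix e' assume "e' \<in> F k"
        with False F(2)[of k] have "e' \<in> E" "e' \<noteq> e" by auto
        then show "L2_inner M f e' * L2_inner M e' e = 0"
          using L2_orthonormalD(2)[OF on _ e] by simp
      qed
      finally have "(norm (L2_inner M f e - L2_inner M (p k) e))\<^sup>2 = q e" by (simp add: q_def)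
      also have "\<dots> = sum q (insert e (F k)) - sum q (F k)" using False F by simp
      also have "\<dots> \<le> inverse (Suc k)" using le_S[of "insert e (F k)"] F e F_S[of k] by simp
      finally show ?thesis .
    qed
    then have "(\<lambda>k. (norm (L2_inner M f e - L2_inner M (p k) e))\<^sup>2) \<longlonglongrightarrow> 0"
      by (intro Lim_null_comparison[OF _ inv0]) auto
    moreover have "(\<lambda>k. (norm (L2_inner M f e - L2_inner M (p k) e))\<^sup>2) \<longlonglongrightarrow>
        (norm (L2_inner M f e - L2_inner M g e))\<^sup>2"
      by (intro tendsto_intros L2_inner_tendsto[OF p g(1) eL2 g(2)])
    ultimately have "(norm (L2_inner M f e - L2_inner M g e))\<^sup>2 = 0"
      by (rule LIMSEQ_unique[symmetric])
    then show ?thesis using f g(1) eL2 by (simp add: L2_inner_diff_left)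
  qed
  then have null: "L2_norm M (\<lambda>x. f x - g x) = 0"
    using E f g(1) by (auto simp: L2_orthonormal_basis_def L2_orthogonal_def)
  have "(\<lambda>k. sum q (F k)) \<longlonglongrightarrow> S"
  proof (rule tendsto_sandwich[where h = "\<lambda>_. S"])
    show "(\<lambda>k. S - inverse (real (Suc k))) \<longlonglongrightarrow> S"
      using tendsto_diff[OF tendsto_const inv0] by simp
    show "\<forall>\<^sub>F k in sequentially. S - inverse (real (Suc k)) \<le> sum q (F k)"
      using F_S by (auto simp: algebra_simps intro!: always_eventually)
  qed (use le_S F in \<open>auto intro!: always_eventually tendsto_const\<close>)
  moreover have "(\<lambda>k. sum q (F k)) \<longlonglongrightarrow> (L2_norm M g)\<^sup>2"
    unfolding p_norm[symmetric] by (intro tendsto_power L2_norm_tendsto[OF p g])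
  ultimately have "(L2_norm M g)\<^sup>2 = S" by (rule LIMSEQ_unique[symmetric])
  moreover have "L2_norm M f = L2_norm M g"
    using L2_norm_triangle_diff[OF f g(1) L2_zero] L2_norm_triangle_diff[OF g(1) f L2_zero] null
    by (simp add: L2_norm_diff_commute[of M g f])
  ultimately show ?thesis using S by (simp add: q_def[abs_def])
qed

subsection \<open>Auxiliary facts on series and sums\<close>

lemma L2_sums_inner_right:
  assumes "L2_sums M v f" "g \<in> L2 M"
  shows "(\<lambda>n. L2_inner M g (v n)) sums L2_inner M g f"
proof -
  have "(\<lambda>n. cnj (L2_inner M (v n) g)) sums cnj (L2_inner M f g)"
    using L2_sums_inner[OF assms] by (simp add: sums_cnj)
  then show ?thesis by (simp flip: L2_inner_commute)
qed

lemma sums_single_term: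
  fixes n :: nat and f :: "nat \<Rightarrow> 'c :: {comm_monoid_add, t2_space}"
  assumes "\<And>m. m \<noteq> n \<Longrightarrow> f m = 0" shows "f sums f n"
  using sums_finite[of "{n}" f] assms by simp

lemma le_if_power2_le_mult:
  fixes a b :: real
  assumes "a\<^sup>2 \<le> b * a" "0 \<le> a" "0 \<le> b" shows "a \<le> b"
  using assms by (cases "a = 0") (auto simp: power2_eq_square)

lemma norm_L2_inner_commute: "norm (L2_inner M f g) = norm (L2_inner M g f)"
  by (subst L2_inner_commute) simp

lemma has_sum_sum:
  fixes f :: "'i \<Rightarrow> 'e \<Rightarrow> 'c :: topological_comm_monoid_add"
  shows "(\<And>i. i \<in> I \<Longrightarrow> (f i has_sum a i) A) \<Longrightarrow> ((\<lambda>x. \<Sum>i\<in>I. f i x) has_sum (\<Sum>i\<in>I. a i)) A"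
  by (induction I rule: infinite_finite_induct) (auto intro: has_sum_add)

section \<open>Positive operators\<close>

lemma L2_bounded_operatorD:
  assumes "L2_bounded_operator M T"
  shows "(f, g) \<in> T \<Longrightarrow> f \<in> L2 M" and "(f, g) \<in> T \<Longrightarrow> g \<in> L2 M"
    and "\<lbrakk>(f, g) \<in> T; (f', g') \<in> T\<rbrakk> \<Longrightarrow> ((\<lambda>x. f x + f' x), (\<lambda>x. g x + g' x)) \<in> T"
    and "(f, g) \<in> T \<Longrightarrow> ((\<lambda>x. c * f x), (\<lambda>x. c * g x)) \<in> T"
  using assms unfolding L2_bounded_operator_def by blast+

lemma op_app_in_graph:
  assumes "L2_bounded_operator M T" "f \<in> L2 M"
  shows "(f, op_app T f) \<in> T" and "op_app T f \<in> L2 M"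
proof -
  from assms have "f \<in> Domain T" by (simp add: L2_bounded_operator_def)
  then obtain g where "(f, g) \<in> T" by blast
  then show "(f, op_app T f) \<in> T" unfolding op_app_def by (rule someI[of "\<lambda>g. (f, g) \<in> T"])
  then show "op_app T f \<in> L2 M" by (rule L2_bounded_operatorD(2)[OF assms(1)])
qed

text \<open>
  The bound, applied to the difference of two pairs over the same \<open>f\<close>, shows that the representative chosen by
  \<open>op_app\<close> differs from \<open>g\<close> by a null function.
\<close>

lemma L2_inner_op_app:
  assumes T: "L2_bounded_operator M T" and fg: "(f, g) \<in> T" and h: "h \<in> L2 M"
  shows "L2_inner M (op_app T f) h = L2_inner M g h"
proof -
  note D = L2_bounded_operatorD[OF T]
  have f: "f \<in> L2 M" and g: "g \<in> L2 M" using D(1,2)[OF fg] .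
  note app = op_app_in_graph[OF T f]
  have "((\<lambda>x. f x + - 1 * f x), (\<lambda>x. op_app T f x + - 1 * g x)) \<in> T"
    by (rule D(3)[OF app(1) D(4)[OF fg]])
  moreover obtain B where "\<forall>(f, g)\<in>T. L2_norm M g \<le> B * L2_norm M f"
    using T by (auto simp: L2_bounded_operator_def)
  ultimately have "L2_norm M (\<lambda>x. op_app T f x - g x) \<le> B * L2_norm M (\<lambda>x. f x + - 1 * f x)"
    by fastforce
  then have "L2_norm M (\<lambda>x. op_app T f x - g x) = 0"
    using L2_norm_nonneg[of M "\<lambda>x. op_app T f x - g x"] by simp
  then show ?thesis by (rule L2_inner_cong_null[OF app(2) g h])
qed

lemma L2_inner_op_app_add:
  assumes T: "L2_bounded_operator M T" and "f \<in> L2 M" "g \<in> L2 M" "h \<in> L2 M"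
  shows "L2_inner M (op_app T (\<lambda>x. f x + g x)) h = L2_inner M (op_app T f) h + L2_inner M (op_app T g) h"
  using L2_inner_op_app[OF T L2_bounded_operatorD(3)[OF T op_app_in_graph(1)[OF T assms(2)]
        op_app_in_graph(1)[OF T assms(3)]] assms(4)] assms
  by (simp add: L2_inner_add_left op_app_in_graph(2)[OF T])

lemma L2_inner_op_app_scale:
  assumes T: "L2_bounded_operator M T" and "f \<in> L2 M" "h \<in> L2 M"
  shows "L2_inner M (op_app T (\<lambda>x. c * f x)) h = c * L2_inner M (op_app T f) h"
  using L2_inner_op_app[OF T L2_bounded_operatorD(4)[OF T op_app_in_graph(1)[OF T assms(2)]] assms(3)]
  by (simp add: L2_inner_scale_left)

text \<open>Polarisation: the quadratic form is real at \<open>f + g\<close> and at \<open>f + \<i> g\<close>.\<close>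

lemma L2_positive_operator_selfadjoint:
  assumes P: "L2_positive_operator M P" and f: "f \<in> L2 M" and g: "g \<in> L2 M"
  shows "L2_inner M (op_app P f) g = L2_inner M f (op_app P g)"
proof -
  have T: "L2_bounded_operator M P" and real: "\<And>f. f \<in> L2 M \<Longrightarrow> Im (L2_inner M (op_app P f) f) = 0"
    using P by (auto simp: L2_positive_operator_def complex_is_Real_iff)
  note app = op_app_in_graph(2)[OF T]
  define a where "a = L2_inner M (op_app P f) g"
  define b where "b = L2_inner M (op_app P g) f"
  have expand: "L2_inner M (op_app P (\<lambda>x. f x + c * g x)) (\<lambda>x. f x + c * g x) =
      L2_inner M (op_app P f) f + cnj c * a + c * b + c * cnj c * L2_inner M (op_app P g) g" for c
    using f g app
    by (simp add: L2_inner_op_app_add[OF T] L2_inner_op_app_scale[OF T] L2_inner_add_right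
        L2_inner_scale_right a_def b_def algebra_simps)
  have "Im (cnj c * a + c * b) = 0" for c
  proof -
    have "Im (L2_inner M (op_app P (\<lambda>x. f x + c * g x)) (\<lambda>x. f x + c * g x)) = 0"
      using f g by (intro real L2_add L2_scale)
    then show ?thesis
      unfolding expand using real[OF f] real[OF g] by (simp add: complex_mult_cnj)
  qed
  from this[of 1] this[of \<i>] have "a = cnj b"
    by (simp add: complex_eq_iff)
  then show ?thesis unfolding a_def b_def by (simp flip: L2_inner_commute)
qed

text \<open>
  Uniqueness of the positive square root, tested on one eigenvector. The two eigenvector hypotheses
  on \<open>T\<close> give \<open>P (P v) = l\<^sup>2 v\<close> in the weak sense. Then \<open>w = P v - l v\<close> satisfies \<open>P w = - l w\<close>, which
  positivity of \<open>P\<close> allows only for a null vector \<open>w\<close>.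
\<close>

lemma L2_absolute_value_eigenvector:
  assumes T: "L2_bounded_operator M T" and abs: "L2_absolute_value M T P"
    and v: "v \<in> L2 M" and "l > 0"
    and eig: "\<And>g. g \<in> L2 M \<Longrightarrow> L2_inner M (op_app T v) g = of_real l * L2_inner M v g"
    and eig': "\<And>g. g \<in> L2 M \<Longrightarrow> L2_inner M v (op_app T g) = of_real l * L2_inner M v g"
    and g: "g \<in> L2 M"
  shows "L2_inner M (op_app P v) g = of_real l * L2_inner M v g"
proof -
  have P: "L2_positive_operator M P"
    and PP: "\<And>f g. \<lbrakk>f \<in> L2 M; g \<in> L2 M\<rbrakk> \<Longrightarrow>
      L2_inner M (op_app P f) (op_app P g) = L2_inner M (op_app T f) (op_app T g)"
    using abs by (auto simp: L2_absolute_value_def)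
  then have bP: "L2_bounded_operator M P"
    and pos: "\<And>f. f \<in> L2 M \<Longrightarrow> 0 \<le> Re (L2_inner M (op_app P f) f)"
    by (auto simp: L2_positive_operator_def)
  note appP = op_app_in_graph(2)[OF bP] and appT = op_app_in_graph(2)[OF T]
  define w where "w = (\<lambda>x. op_app P v x - of_real l * v x)"
  have w: "w \<in> L2 M" unfolding w_def by (intro L2_diff L2_scale appP v)
  have w_inner: "L2_inner M w h = L2_inner M (op_app P v) h - of_real l * L2_inner M v h"
    if "h \<in> L2 M" for h
    using that v appP unfolding w_def by (simp add: L2_inner_diff_left L2_inner_scale_left)
  have "L2_inner M w (op_app P w) = - of_real l * L2_inner M w w"
  proof -
    have "L2_inner M (op_app P v) (op_app P w) = of_real l * (of_real l * L2_inner M v w)"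
      using v w by (simp add: PP eig eig' appT)
    then show ?thesis
      unfolding w_inner[OF w] w_inner[OF appP[OF w]] L2_positive_operator_selfadjoint[OF P v w, symmetric]
      by (simp add: algebra_simps)
  qed
  then have "Re (L2_inner M (op_app P w) w) = - l * (L2_norm M w)\<^sup>2"
    by (subst L2_positive_operator_selfadjoint[OF P w w]) (simp add: L2_inner_self)
  with pos[OF w] have "l * (L2_norm M w)\<^sup>2 \<le> 0" by simp
  with \<open>l > 0\<close> have "L2_norm M w = 0" by (simp add: mult_le_0_iff)
  then show ?thesis using L2_inner_null_left[OF w g] w_inner[OF g] by simp
qed

section \<open>Filtrations with finite orthonormal bases\<close>

text \<open>
  The family \<open>u n\<close>, indexed by \<open>W n\<close>, is an orthonormal basis of a finite-dimensional space \<open>C n\<close>. That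
  these spaces increase is expressed by orthogonal complements, so that it is required only up
  to null functions.
\<close>

locale L2_filtration = prob_space M for M :: "'b measure" +
  fixes W :: "nat \<Rightarrow> 'w set" and u :: "nat \<Rightarrow> 'w \<Rightarrow> 'b \<Rightarrow> complex"
  assumes finite_W: "finite (W n)"
    and orthonormal: "L2_orthonormal M (W n) (u n)"
    and nested: "\<lbrakk>f \<in> L2 M; \<forall>w\<in>W (Suc n). L2_inner M f (u (Suc n) w) = 0; w \<in> W n\<rbrakk> \<Longrightarrow>
      L2_inner M f (u n w) = 0"
    and total: "\<lbrakk>f \<in> L2 M; \<forall>n. \<forall>w\<in>W n. L2_inner M f (u n w) = 0\<rbrakk> \<Longrightarrow> L2_norm M f = 0"
begin

definition C :: "nat \<Rightarrow> ('b \<Rightarrow> complex) set" where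
  "C n = {\<lambda>x. \<Sum>w\<in>W n. c w * u n w x | c. True}"

definition eigenspace :: "nat \<Rightarrow> ('b \<Rightarrow> complex) set" where
  "eigenspace n = (case n of 0 \<Rightarrow> C 0 | Suc m \<Rightarrow> C n \<inter> L2_orthogonal M (C m))"

definition perp :: "nat \<Rightarrow> ('b \<Rightarrow> complex) \<Rightarrow> bool" where
  "perp n f \<longleftrightarrow> f \<in> L2 M \<and> (\<forall>w\<in>W n. L2_inner M f (u n w) = 0)"

abbreviation proj :: "nat \<Rightarrow> ('b \<Rightarrow> complex) \<Rightarrow> 'b \<Rightarrow> complex" where
  "proj n \<equiv> L2_proj M (W n) (u n)"

text \<open>
  The component of \<open>f\<close> in \<open>eigenspace n\<close>. The function \<open>proj (Suc m) f - proj m f\<close> represents the same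
  vector, but need not be literally a member of \<open>C (Suc m)\<close>: the spaces are nested only up to null functions.
  Projecting the residual instead yields a member.
\<close>

definition component :: "nat \<Rightarrow> ('b \<Rightarrow> complex) \<Rightarrow> 'b \<Rightarrow> complex" where
  "component n f = (case n of 0 \<Rightarrow> proj 0 f | Suc m \<Rightarrow> proj n (\<lambda>x. f x - proj m f x))"

text \<open>
  Multiplication by \<open>n\<close> on \<open>eigenspace n\<close>, with its maximal domain.
\<close>

definition number_op :: "'b L2_operator" where
  "number_op = {(f, g). \<exists>v. (\<forall>n. v n \<in> eigenspace n) \<and>
     summable (\<lambda>n. (real n * L2_norm M (v n))\<^sup>2) \<and>
     L2_sums M v f \<and> L2_sums M (\<lambda>n x. of_nat n * v n x) g}"

lemma u_L2 [simp, intro]: "w \<in> W n \<Longrightarrow> u n w \<in> L2 M"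
  using orthonormal by (rule L2_orthonormalD)

lemma C_L2: "f \<in> C n \<Longrightarrow> f \<in> L2 M"
  by (auto simp: C_def)

lemma u_in_C: "w \<in> W n \<Longrightarrow> u n w \<in> C n"
  unfolding C_def using finite_W
  by (auto intro!: exI[of _ "\<lambda>v. of_bool (v = w)"] simp: of_bool_def if_distrib[of "\<lambda>a. a * _"] cong: if_cong)

lemma proj_L2 [simp, intro]: "proj n f \<in> L2 M"
  by (rule L2_proj_in_L2[OF orthonormal])

lemma proj_in_C: "proj n f \<in> C n"
  by (auto simp: C_def L2_proj_def)

lemma perp_Suc:
  assumes "perp (Suc n) f" shows "perp n f"
  using nested[of f n] assms by (simp add: perp_def)

lemma perp_antimono:
  assumes "perp n f" "m \<le> n" shows "perp m f"
  using assms(2)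
proof (induction rule: inc_induct)
  case base show ?case by (rule assms(1))
next
  case (step m) show ?case by (rule perp_Suc[OF step.IH])
qed

lemma perp_C: "\<lbrakk>perp n f; c \<in> C n\<rbrakk> \<Longrightarrow> L2_inner M f c = 0"
  by (auto simp: perp_def C_def L2_inner_sum_right L2_inner_scale_right)

lemma perp_iff_orthogonal: "perp n f \<longleftrightarrow> f \<in> L2_orthogonal M (C n)"
proof
  assume f: "perp n f"
  then show "f \<in> L2_orthogonal M (C n)"
    using perp_C[OF f] by (auto simp: L2_orthogonal_def perp_def)
qed (auto simp: perp_def L2_orthogonal_def u_in_C)

lemma perp_residual: "f \<in> L2 M \<Longrightarrow> perp n (\<lambda>x. f x - proj n f x)"
  using L2_inner_residual[OF orthonormal finite_W] by (simp add: perp_def L2_diff)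

lemma perp_diff: "\<lbrakk>perp n f; perp n g\<rbrakk> \<Longrightarrow> perp n (\<lambda>x. f x - g x)"
  by (auto simp: perp_def L2_inner_diff_left)

lemma eigenspace_C: "eigenspace n \<subseteq> C n"
  by (auto simp: eigenspace_def split: nat.splits)

lemma eigenspace_L2: "k \<in> eigenspace n \<Longrightarrow> k \<in> L2 M"
  using eigenspace_C C_L2 by blast

lemma eigenspace_perp: "k \<in> eigenspace (Suc n) \<Longrightarrow> perp n k"
  by (simp add: eigenspace_def perp_iff_orthogonal)

lemma eigenspace_zero: "(\<lambda>x. 0) \<in> eigenspace n"
proof -
  have "(\<lambda>x. 0) \<in> C n" by (auto simp: C_def intro!: exI[of _ "\<lambda>_. 0"])
  then show ?thesis by (auto simp: eigenspace_def L2_orthogonal_def split: nat.splits)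
qed

lemma eigenspace_orthogonal:
  assumes "k \<in> eigenspace m" "k' \<in> eigenspace n" "m \<noteq> n" shows "L2_inner M k k' = 0"
proof -
  have *: "L2_inner M k k' = 0" if k: "k \<in> eigenspace m" "k' \<in> eigenspace n" "n < m" for k k' m n
  proof -
    obtain m' where m: "m = Suc m'" "n \<le> m'" using k(3) by (cases m) auto
    have "perp n k" by (rule perp_antimono[OF eigenspace_perp m(2)]) (use k(1) m(1) in simp)
    then show ?thesis using eigenspace_C k(2) by (blast intro: perp_C)
  qed
  show ?thesis
    using *[OF assms(1,2)] *[OF assms(2,1)] L2_inner_commute[of M k k'] assms(3)
    by (cases "n < m") auto
qed

lemma component_K: assumes "f \<in> L2 M" shows "component n f \<in> eigenspace n"
proof (cases n)
  case 0 then show ?thesis by (simp add: component_def eigenspace_def proj_in_C)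
next
  case (Suc m)
  let ?g = "\<lambda>x. f x - proj m f x"
  have g: "?g \<in> L2 M" using assms by auto
  have "perp m (\<lambda>x. ?g x - (?g x - proj (Suc m) ?g x))"
    by (rule perp_diff[OF perp_residual[OF assms] perp_antimono[OF perp_residual[OF g]]]) simp
  then show ?thesis by (simp add: Suc component_def eigenspace_def proj_in_C flip: perp_iff_orthogonal)
qed

lemma component_L2 [simp, intro]: "f \<in> L2 M \<Longrightarrow> component n f \<in> L2 M"
  by (rule eigenspace_L2[OF component_K])

text \<open>
  A vector \<open>k\<close> of \<open>eigenspace n\<close> is orthogonal to \<open>C (n - 1)\<close> and lies in \<open>C n\<close>. Hence neither subtracting the
  projection to \<open>C (n - 1)\<close> nor projecting to \<open>C n\<close> changes the inner product with \<open>k\<close>.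
\<close>

lemma component_inner:
  assumes f: "f \<in> L2 M" and k: "k \<in> eigenspace n" shows "L2_inner M (component n f) k = L2_inner M f k"
proof -
  have kC: "k \<in> C n" and kL2: "k \<in> L2 M" using k eigenspace_C eigenspace_L2 by auto
  have proj: "L2_inner M (proj n g) k = L2_inner M g k" if "g \<in> L2 M" for g
    using perp_C[OF perp_residual[OF that] kC] that kL2 by (simp add: L2_inner_diff_left)
  show ?thesis
  proof (cases n)
    case 0 then show ?thesis using proj f by (simp add: component_def)
  next
    case (Suc m)
    have "L2_inner M k (proj m f) = 0"
      by (rule perp_C[OF eigenspace_perp proj_in_C]) (use k Suc in simp)
    then have "L2_inner M (proj m f) k = 0" by (subst L2_inner_commute) simp
    then show ?thesis using proj[of "\<lambda>x. f x - proj m f x"] f kL2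
      by (simp add: Suc component_def L2_inner_diff_left L2_diff)
  qed
qed

lemma component_inner_self:
  assumes f: "f \<in> L2 M" shows "L2_inner M f (component n f) = of_real ((L2_norm M (component n f))\<^sup>2)"
  using component_inner[OF f component_K[OF f, of n]] by (simp add: L2_inner_self)

lemma component_orthogonal:
  "\<lbrakk>f \<in> L2 M; g \<in> L2 M; m \<noteq> n\<rbrakk> \<Longrightarrow> L2_inner M (component m f) (component n g) = 0"
  by (rule eigenspace_orthogonal[OF component_K component_K])

text \<open>
  The eigenspaces up to \<open>n\<close> span \<open>C n\<close>: a member \<open>c\<close> of \<open>C (Suc n)\<close> is the sum of its projection to \<open>C n\<close> and
  its component, up to a remainder \<open>z\<close> that is orthogonal to itself.
\<close>

lemma perp_if_orthogonal_eigenspaces: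
  assumes r: "r \<in> L2 M" and "\<And>m k. \<lbrakk>m \<le> n; k \<in> eigenspace m\<rbrakk> \<Longrightarrow> L2_inner M r k = 0"
  shows "perp n r"
  using assms(2)
proof (induction n)
  case 0
  then show ?case using r u_in_C by (auto simp: perp_def eigenspace_def)
next
  case (Suc n)
  have IH: "perp n r"
  proof (rule Suc.IH)
    fix m k assume "m \<le> n" "k \<in> eigenspace m"
    then show "L2_inner M r k = 0" by (intro Suc.prems[of m]) auto
  qed
  have "L2_inner M r c = 0" if c: "c \<in> C (Suc n)" for c
  proof -
    have cL2: "c \<in> L2 M" using c by (rule C_L2)
    define z where "z = (\<lambda>x. (c x - proj n c x) - component (Suc n) c x)"
    have pz: "perp (Suc n) z"
      unfolding z_def component_def nat.case using cL2 by (intro perp_residual L2_diff proj_L2)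
    then have z: "z \<in> L2 M" by (simp add: perp_def)
    have zc: "L2_inner M z c = 0" by (rule perp_C[OF pz c])
    have zproj: "L2_inner M z (proj n c) = 0" by (rule perp_C[OF perp_Suc[OF pz] proj_in_C])
    have zcomp: "L2_inner M z (component (Suc n) c) = 0"
      using component_K[OF cL2] eigenspace_C by (intro perp_C[OF pz]) auto
    have "L2_inner M z z = L2_inner M z (\<lambda>x. (c x - proj n c x) - component (Suc n) c x)"
      by (simp add: z_def)
    also have "\<dots> = 0" using z zc zproj zcomp cL2 by (simp add: L2_inner_diff_right L2_diff)
    finally have "L2_norm M z = 0" by (simp add: L2_inner_self)
    then have "L2_inner M z r = 0" by (rule L2_inner_null_left[OF z r])
    then have "L2_inner M r z = 0" by (subst L2_inner_commute) simp
    moreover have "L2_inner M r (component (Suc n) c) = 0" using Suc.prems component_K[OF cL2] by blast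
    moreover have "L2_inner M r (proj n c) = 0" by (rule perp_C[OF IH proj_in_C])
    ultimately show ?thesis
      using r cL2 unfolding z_def by (simp add: L2_inner_diff_right L2_diff)
  qed
  then show ?case using r by (simp add: perp_def u_in_C)
qed

lemma eigenspace_total:
  assumes "h \<in> L2 M" "\<And>n k. k \<in> eigenspace n \<Longrightarrow> L2_inner M h k = 0"
  shows "L2_norm M h = 0"
proof (rule total[OF assms(1)], intro allI ballI)
  fix n w assume "w \<in> W n"
  moreover have "perp n h" by (rule perp_if_orthogonal_eigenspaces[OF assms])
  ultimately show "L2_inner M h (u n w) = 0" by (simp add: perp_def)
qed

text \<open>
  With \<open>k\<close> the component of \<open>f\<close>, the squared norm of \<open>k\<close> is \<open>\<langle>f, k\<rangle> = \<langle>proj n f, k\<rangle>\<close>, to which the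
  Cauchy--Schwarz inequality applies.
\<close>

lemma component_norm_le_proj:
  assumes f: "f \<in> L2 M" shows "(L2_norm M (component n f))\<^sup>2 \<le> (\<Sum>w\<in>W n. (norm (L2_inner M f (u n w)))\<^sup>2)"
proof -
  let ?k = "component n f"
  have kC: "?k \<in> C n" using component_K[OF f] eigenspace_C by blast
  have "L2_inner M (proj n f) ?k = L2_inner M f ?k"
    using perp_C[OF perp_residual[OF f] kC] f by (simp add: L2_inner_diff_left)
  then have "(L2_norm M ?k)\<^sup>2 = norm (L2_inner M (proj n f) ?k)"
    using component_inner_self[OF f, of n] by (simp add: norm_power)
  also have "\<dots> \<le> L2_norm M (proj n f) * L2_norm M ?k"
    using f by (intro L2_Cauchy_Schwarz) auto
  finally have "L2_norm M ?k \<le> L2_norm M (proj n f)"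
    by (rule le_if_power2_le_mult) simp_all
  then have "(L2_norm M ?k)\<^sup>2 \<le> (L2_norm M (proj n f))\<^sup>2" by (rule power_mono) simp
  then show ?thesis by (simp add: L2_norm_proj[OF orthonormal finite_W])
qed

lemma component_Bessel:
  assumes f: "f \<in> L2 M" shows "(\<Sum>n<N. (L2_norm M (component n f))\<^sup>2) \<le> (L2_norm M f)\<^sup>2"
proof -
  let ?p = "\<lambda>x. \<Sum>n<N. component n f x"
  have p: "(L2_norm M ?p)\<^sup>2 = (\<Sum>n<N. (L2_norm M (component n f))\<^sup>2)"
    using f by (intro L2_norm_sum_orthogonal) (auto intro: component_orthogonal)
  have "L2_inner M f ?p = of_real ((L2_norm M ?p)\<^sup>2)"
    using f unfolding p by (simp add: L2_inner_sum_right component_inner_self)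
  then have "(L2_norm M ?p)\<^sup>2 \<le> L2_norm M f * L2_norm M ?p"
    using L2_Cauchy_Schwarz[of f M ?p] f by (simp add: L2_sum norm_power)
  then have "L2_norm M ?p \<le> L2_norm M f"
    by (rule le_if_power2_le_mult) simp_all
  then have "(L2_norm M ?p)\<^sup>2 \<le> (L2_norm M f)\<^sup>2" by (rule power_mono) simp
  then show ?thesis by (simp add: p)
qed

lemma component_summable:
  assumes f: "f \<in> L2 M" shows "summable (\<lambda>n. (L2_norm M (component n f))\<^sup>2)"
  using component_Bessel[OF f] by (intro summableI_nonneg_bounded) auto

text \<open>
  The series of components converges by completeness. Its sum has the same inner products with
  all eigenspaces as \<open>f\<close>, and these are total.
\<close>

lemma component_sums:
  assumes f: "f \<in> L2 M" shows "L2_sums M (\<lambda>n. component n f) f"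
proof -
  obtain g where g: "L2_sums M (\<lambda>n. component n f) g"
    using L2_orthogonal_series[OF component_L2[OF f] component_orthogonal[OF f f] component_summable[OF f]] by blast
  then have gL2: "g \<in> L2 M" by (simp add: L2_sums_def)
  have null: "L2_norm M (\<lambda>x. g x - f x) = 0"
  proof (rule eigenspace_total)
    fix n k assume k: "k \<in> eigenspace n"
    have "(\<lambda>m. L2_inner M (component m f) k) sums L2_inner M g k"
      by (rule L2_sums_inner[OF g eigenspace_L2[OF k]])
    moreover have "(\<lambda>m. L2_inner M (component m f) k) sums L2_inner M (component n f) k"
      using eigenspace_orthogonal[OF component_K[OF f] k] by (intro sums_single_term) auto
    ultimately have "L2_inner M g k = L2_inner M (component n f) k" by (rule sums_unique2)
    then show "L2_inner M (\<lambda>x. g x - f x) k = 0"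
      using component_inner[OF f k] gL2 f eigenspace_L2[OF k] by (simp add: L2_inner_diff_left)
  qed (use gL2 f in auto)
  have "(\<lambda>N. L2_norm M (\<lambda>x. (\<Sum>n<N. component n f x) - g x)) \<longlonglongrightarrow> 0"
    using g by (simp add: L2_sums_def)
  then have "(\<lambda>N. L2_norm M (\<lambda>x. (\<Sum>n<N. component n f x) - f x)) \<longlonglongrightarrow> 0"
  proof (rule Lim_null_comparison[rotated])
    show "\<forall>\<^sub>F N in sequentially. norm (L2_norm M (\<lambda>x. (\<Sum>n<N. component n f x) - f x))
        \<le> L2_norm M (\<lambda>x. (\<Sum>n<N. component n f x) - g x)"
      using L2_norm_triangle_diff[OF L2_sum gL2 f, of _ "\<lambda>n. component n f"] f null
      by (auto intro!: always_eventually)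
  qed
  then show ?thesis using f by (simp add: L2_sums_def)
qed

lemma component_norm_sums:
  assumes f: "f \<in> L2 M" shows "(\<lambda>n. (L2_norm M (component n f))\<^sup>2) sums (L2_norm M f)\<^sup>2"
proof -
  have "(\<lambda>n. complex_of_real ((L2_norm M (component n f))\<^sup>2)) sums of_real ((L2_norm M f)\<^sup>2)"
    using L2_sums_inner_right[OF component_sums[OF f] f] f by (simp add: component_inner_self L2_inner_self)
  then show ?thesis by (simp only: sums_of_real_iff)
qed

subsection \<open>The exponential of the number operator\<close>

abbreviation exp_op :: "real \<Rightarrow> 'b L2_operator" where
  "exp_op s \<equiv> op_exp M (- s) number_op"

text \<open>
  The operator is diagonal. If \<open>v\<close> is an eigenvector of the number operator for \<open>l\<close>, then its inner
  product with a vector of \<open>eigenspace n\<close> vanishes unless \<open>l = n\<close>, so that \<open>exp (- s l)\<close> may be replaced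
  by \<open>exp (- s n)\<close>; summation over the eigenvectors gives one direction. For the other, the components
  of \<open>f\<close> are the required orthogonal eigenvectors.
\<close>

lemma exp_op_iff:
  fixes s :: real
  shows
  "(f, g) \<in> exp_op s \<longleftrightarrow> f \<in> L2 M \<and> g \<in> L2 M \<and>
     (\<forall>n. \<forall>k\<in>eigenspace n. L2_inner M g k = of_real (exp (- s * n)) * L2_inner M f k)" (is "?L \<longleftrightarrow> ?R")
proof
  assume ?L
  then obtain v l where D: "\<And>j. (v j, \<lambda>x. of_real (l j) * v j x) \<in> number_op"
    and f: "L2_sums M v f" and g: "L2_sums M (\<lambda>j x. of_real (exp (- s * l j)) * v j x) g"
    by (auto simp: op_exp_def op_fun_def)
  have "L2_inner M g k = of_real (exp (- s * n)) * L2_inner M f k" if k: "k \<in> eigenspace n" for n k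
  proof -
    have kL2: "k \<in> L2 M" using k by (rule eigenspace_L2)
    have eq: "of_real (exp (- s * l j)) * L2_inner M (v j) k = of_real (exp (- s * n)) * L2_inner M (v j) k" for j
    proof -
      obtain y where y: "\<And>m. y m \<in> eigenspace m" "L2_sums M y (v j)"
          "L2_sums M (\<lambda>m x. of_nat m * y m x) (\<lambda>x. of_real (l j) * v j x)"
        using D[of j] by (auto simp: number_op_def)
      have yk: "L2_inner M (y m) k = 0" if "m \<noteq> n" for m
        using eigenspace_orthogonal[OF y(1) k that] .
      have "L2_inner M (v j) k = L2_inner M (y n) k"
        using L2_sums_inner[OF y(2) kL2] sums_single_term[of n "\<lambda>m. L2_inner M (y m) k"] yk
        by (metis sums_unique2)
      moreover have "of_real (l j) * L2_inner M (v j) k = of_nat n * L2_inner M (y n) k"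
      proof (rule sums_unique2)
        show "(\<lambda>m. of_nat m * L2_inner M (y m) k) sums (of_real (l j) * L2_inner M (v j) k)"
          using L2_sums_inner[OF y(3) kL2] by (simp add: L2_inner_scale_left)
        show "(\<lambda>m. of_nat m * L2_inner M (y m) k) sums (of_nat n * L2_inner M (y n) k)"
          using sums_single_term[of n "\<lambda>m. of_nat m * L2_inner M (y m) k"] yk by simp
      qed
      ultimately have "complex_of_real (l j - n) * L2_inner M (v j) k = 0"
        by (simp add: left_diff_distrib)
      then have "l j = n \<or> L2_inner M (v j) k = 0"
        unfolding mult_eq_0_iff of_real_eq_0_iff by auto
      then show ?thesis by auto
    qed
    have "(\<lambda>j. of_real (exp (- s * n)) * L2_inner M (v j) k) sums L2_inner M g k"
      using L2_sums_inner[OF g kL2] unfolding L2_inner_scale_left eq .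
    moreover have "(\<lambda>j. of_real (exp (- s * n)) * L2_inner M (v j) k) sums (of_real (exp (- s * n)) * L2_inner M f k)"
      by (intro sums_mult L2_sums_inner[OF f kL2])
    ultimately show ?thesis by (rule sums_unique2)
  qed
  then show ?R using f g by (auto simp: L2_sums_def)
next
  assume R: ?R
  then have f: "f \<in> L2 M" and g: "g \<in> L2 M"
    and gk: "\<And>n k. k \<in> eigenspace n \<Longrightarrow> L2_inner M g k = of_real (exp (- s * n)) * L2_inner M f k" by auto
  have D: "(component j f, \<lambda>x. of_real (real j) * component j f x) \<in> number_op" for j
  proof -
    define y where "y m = (if m = j then component j f else (\<lambda>x. 0))" for m
    have fin: "L2_sums M (\<lambda>m x. of_nat m ^ i * y m x) (\<lambda>x. of_nat j ^ i * component j f x)" for i :: nat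
    proof -
      have "(\<lambda>N. L2_norm M (\<lambda>x. (\<Sum>m<N. of_nat m ^ i * y m x) - of_nat j ^ i * component j f x)) \<longlonglongrightarrow> 0"
      proof (rule tendsto_eventually, rule eventually_sequentiallyI[of "Suc j"])
        fix N assume "Suc j \<le> N"
        then have "(\<Sum>m<N. of_nat m ^ i * y m x) = of_nat j ^ i * component j f x" for x
          by (simp add: y_def if_distrib[of "\<lambda>h. _ * h _"] cong: if_cong)
        then show "L2_norm M (\<lambda>x. (\<Sum>m<N. of_nat m ^ i * y m x) - of_nat j ^ i * component j f x) = 0" by simp
      qed
      then show ?thesis using f by (auto simp: L2_sums_def y_def)
    qed
    have "summable (\<lambda>n. (real n * L2_norm M (y n))\<^sup>2)"
      by (rule summable_finite[of "{j}"]) (auto simp: y_def)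
    moreover have "\<forall>n. y n \<in> eigenspace n" using component_K[OF f] eigenspace_zero by (simp add: y_def)
    ultimately show ?thesis using fin[of 0] fin[of 1] unfolding number_op_def by auto
  qed
  have eq: "L2_norm M (\<lambda>x. component n g x - of_real (exp (- s * n)) * component n f x) = 0" for n
  proof -
    let ?a = "complex_of_real (exp (- s * n))"
    let ?h = "\<lambda>x. component n g x - ?a * component n f x"
    have hL2: "?h \<in> L2 M" using f g by (intro L2_diff L2_scale component_L2)
    have "L2_inner M ?h k = 0" if "k \<in> eigenspace n" for k
      using component_inner[OF f that] component_inner[OF g that] gk[OF that] f g eigenspace_L2[OF that]
      by (simp add: L2_inner_diff_left L2_inner_scale_left)
    then have "L2_inner M ?h (component n g) = 0" "L2_inner M ?h (component n f) = 0"
      using component_K f g by auto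
    then have "L2_inner M ?h ?h = 0"
      using hL2 f g by (subst L2_inner_diff_right) (auto simp: L2_inner_scale_right)
    then show ?thesis by (simp add: L2_inner_self)
  qed
  have sg: "L2_sums M (\<lambda>j x. of_real (exp (- s * real j)) * component j f x) g"
  proof -
    let ?a = "\<lambda>j. complex_of_real (exp (- s * real j))"
    have "L2_norm M (\<lambda>x. (\<Sum>j<N. ?a j * component j f x) - (\<Sum>j<N. component j g x)) = 0" for N
    proof (induction N)
      case (Suc N)
      have "L2_norm M (\<lambda>x. ((\<Sum>j<N. ?a j * component j f x) - (\<Sum>j<N. component j g x)) + (?a N * component N f x - component N g x))
          \<le> L2_norm M (\<lambda>x. (\<Sum>j<N. ?a j * component j f x) - (\<Sum>j<N. component j g x)) + L2_norm M (\<lambda>x. ?a N * component N f x - component N g x)"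
        using f g by (intro L2_norm_triangle L2_diff L2_sum L2_scale component_L2)
      also have "\<dots> = 0" using Suc eq[of N] L2_norm_diff_commute[of M "component N g"] by simp
      finally show ?case by (intro antisym L2_norm_nonneg) (simp add: algebra_simps)
    qed simp
    then have le: "L2_norm M (\<lambda>x. (\<Sum>j<N. ?a j * component j f x) - g x) \<le> L2_norm M (\<lambda>x. (\<Sum>j<N. component j g x) - g x)" for N
      using L2_norm_triangle_diff[of "\<lambda>x. \<Sum>j<N. ?a j * component j f x" M "\<lambda>x. \<Sum>j<N. component j g x" g] f g
      by (simp add: L2_sum L2_scale)
    have "(\<lambda>N. L2_norm M (\<lambda>x. (\<Sum>j<N. component j g x) - g x)) \<longlonglongrightarrow> 0"
      using component_sums[OF g] by (simp add: L2_sums_def)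
    then have "(\<lambda>N. L2_norm M (\<lambda>x. (\<Sum>j<N. ?a j * component j f x) - g x)) \<longlonglongrightarrow> 0"
      by (rule Lim_null_comparison[rotated]) (use le in auto)
    then show ?thesis using f g by (auto simp: L2_sums_def)
  qed
  show ?L unfolding op_exp_def op_fun_def
    using D component_orthogonal[OF f f] component_sums[OF f] sg
    by (auto intro!: exI[of _ "\<lambda>j. component j f"] exI[of _ real])
qed

lemma exp_op_inner_sums:
  fixes s :: real
  assumes fg: "(f, g) \<in> exp_op s"
  shows "(\<lambda>n. exp (- s * n) * (L2_norm M (component n f))\<^sup>2) sums Re (L2_inner M g f)"
    and "L2_inner M g f \<in> \<real>"
proof -
  have f: "f \<in> L2 M" and g: "g \<in> L2 M" using fg by (auto simp: exp_op_iff)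
  have "(\<lambda>n. L2_inner M g (component n f)) sums L2_inner M g f"
    by (rule L2_sums_inner_right[OF component_sums[OF f] g])
  moreover have "L2_inner M g (component n f) = of_real (exp (- s * n) * (L2_norm M (component n f))\<^sup>2)" for n
    using fg component_K[OF f, of n] component_inner_self[OF f, of n] by (simp add: exp_op_iff)
  ultimately have *: "(\<lambda>n. complex_of_real (exp (- s * n) * (L2_norm M (component n f))\<^sup>2)) sums L2_inner M g f"
    by (simp only:)
  from sums_Re[OF *] show "(\<lambda>n. exp (- s * n) * (L2_norm M (component n f))\<^sup>2) sums Re (L2_inner M g f)"
    by simp
  show "L2_inner M g f \<in> \<real>" using sums_Im[OF *] by (simp add: complex_is_Real_iff sums_iff)
qed

text \<open>
  Since the factors \<open>exp (- s n)\<close> are at most one, Bessel's inequality for the components of \<open>f\<close> makes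
  the image series converge, and its sum has norm at most that of \<open>f\<close>.
\<close>

lemma exp_op_bounded:
  assumes s: "s > 0" shows "L2_bounded_operator M (exp_op s)"
proof -
  have "\<exists>g. (f, g) \<in> exp_op s" if f: "f \<in> L2 M" for f
  proof -
    let ?v = "\<lambda>n x. complex_of_real (exp (- s * real n)) * component n f x"
    have le1: "exp (- s * real n) \<le> 1" for n using s by simp
    have vL2: "?v n \<in> L2 M" for n using f by (intro L2_scale component_L2)
    have vsum: "summable (\<lambda>n. (L2_norm M (?v n))\<^sup>2)"
    proof (rule summable_comparison_test_ev[OF always_eventually component_summable[OF f]], rule allI)
      fix n
      have "L2_norm M (?v n) \<le> 1 * L2_norm M (component n f)"
        unfolding L2_norm_scale using le1[of n] by (intro mult_right_mono) auto
      then show "norm ((L2_norm M (?v n))\<^sup>2) \<le> (L2_norm M (component n f))\<^sup>2"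
        by (simp add: power_mono)
    qed
    have "L2_inner M (?v m) (?v n) = 0" if "m \<noteq> n" for m n
      using component_orthogonal[OF f f that] by (simp only: L2_inner_scale_left L2_inner_scale_right) simp
    from L2_orthogonal_series[of ?v, OF vL2 this vsum] obtain g where g: "L2_sums M ?v g" by blast
    have "L2_inner M g k = of_real (exp (- s * n)) * L2_inner M f k" if k: "k \<in> eigenspace n" for n k
    proof -
      have "(\<lambda>m. L2_inner M (?v m) k) sums L2_inner M (?v n) k"
        using eigenspace_orthogonal[OF component_K[OF f] k] by (intro sums_single_term) (simp only: L2_inner_scale_left, simp)
      from sums_unique2[OF L2_sums_inner[OF g eigenspace_L2[OF k]] this]
      have "L2_inner M g k = L2_inner M (?v n) k" .
      then show ?thesis using component_inner[OF f k] by (simp only: L2_inner_scale_left)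
    qed
    then have "(f, g) \<in> exp_op s" using f g by (auto simp: exp_op_iff L2_sums_def)
    then show ?thesis by blast
  qed
  then have "L2 M \<subseteq> Domain (exp_op s)" by blast
  then have "Domain (exp_op s) = L2 M" by (auto simp: exp_op_iff)
  moreover have "L2_norm M g \<le> L2_norm M f" if fg: "(f, g) \<in> exp_op s" for f g
  proof -
    have f: "f \<in> L2 M" and g: "g \<in> L2 M" using fg by (auto simp: exp_op_iff)
    have gk: "L2_inner M g k = of_real (exp (- s * n)) * L2_inner M f k" if "k \<in> eigenspace n" for n k
      using fg that unfolding exp_op_iff by blast
    have "L2_norm M (component n g) \<le> L2_norm M (component n f)" for n
    proof -
      have "of_real ((L2_norm M (component n g))\<^sup>2) = of_real (exp (- s * n)) * L2_inner M f (component n g)"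
        using gk[OF component_K[OF g, of n]] component_inner_self[OF g, of n] by simp
      also have "\<dots> = of_real (exp (- s * n)) * L2_inner M (component n f) (component n g)"
        using component_inner[OF f component_K[OF g]] by simp
      finally have "complex_of_real ((L2_norm M (component n g))\<^sup>2) = \<dots>" .
      from arg_cong[OF this, of norm]
      have "(L2_norm M (component n g))\<^sup>2 = exp (- s * n) * norm (L2_inner M (component n f) (component n g))"
        by (simp add: norm_mult norm_power)
      also have "\<dots> \<le> 1 * (L2_norm M (component n f) * L2_norm M (component n g))"
        using f g s by (intro mult_mono L2_Cauchy_Schwarz) auto
      finally have "(L2_norm M (component n g))\<^sup>2 \<le> L2_norm M (component n f) * L2_norm M (component n g)" by simp
      then show ?thesis by (rule le_if_power2_le_mult) simp_all
    qed
    then have "(L2_norm M (component n g))\<^sup>2 \<le> (L2_norm M (component n f))\<^sup>2" for n by (simp add: power_mono)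
    then have "(L2_norm M g)\<^sup>2 \<le> (L2_norm M f)\<^sup>2"
      by (rule sums_le[OF _ component_norm_sums[OF g] component_norm_sums[OF f]])
    then show ?thesis by (rule power2_le_imp_le) simp
  qed
  then have "\<exists>B. \<forall>(f, g)\<in>exp_op s. L2_norm M g \<le> B * L2_norm M f"
    by (intro exI[of _ 1]) auto
  ultimately show ?thesis
    unfolding L2_bounded_operator_def
    by (auto simp: exp_op_iff L2_inner_add_left L2_inner_scale_left eigenspace_L2 distrib_left)
qed

text \<open>
  The operator is its own absolute value. For a finite part \<open>F\<close> of any orthonormal basis, Bessel's inequality
  for \<open>F\<close> and the unit vectors \<open>u n w\<close> bounds the sum of the squared norms of the components
  in \<open>eigenspace n\<close> by \<open>card (W n)\<close>.
\<close>

theorem exp_op_trace_class: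
  fixes s :: real
  assumes s: "s > 0" and sum: "summable (\<lambda>n. exp (- s * n) * card (W n))"
  shows "trace_class M (exp_op s)"
proof -
  note bd = exp_op_bounded[OF s]
  note app = op_app_in_graph(1)[OF bd]
  obtain E where E: "L2_orthonormal_basis M E" using L2_orthonormal_basis_exists by blast
  note on = L2_orthonormal_basis_orthonormal[OF E]
  note q = exp_op_inner_sums[OF app]
  have q_nonneg: "0 \<le> Re (L2_inner M (op_app (exp_op s) f) f)" if "f \<in> L2 M" for f
    by (rule sums_le[OF _ sums_zero q(1)[OF that]]) simp
  have "L2_absolute_value M (exp_op s) (exp_op s)"
    using bd q(2) q_nonneg by (simp add: L2_absolute_value_def L2_positive_operator_def)
  moreover have "(\<lambda>e. Re (L2_inner M (op_app (exp_op s) e) e)) summable_on E"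
  proof (rule nonneg_bdd_above_summable_on)
    show "bdd_above (sum (\<lambda>e. Re (L2_inner M (op_app (exp_op s) e) e)) ` {F. F \<subseteq> E \<and> finite F})"
    proof (rule bdd_aboveI2)
      fix F assume "F \<in> {F. F \<subseteq> E \<and> finite F}"
      then have F: "finite F" "F \<subseteq> E" by auto
      have FL2: "e \<in> L2 M" if "e \<in> F" for e using that F(2) L2_orthonormalD(1)[OF on] by auto
      have "(\<Sum>e\<in>F. exp (- s * n) * (L2_norm M (component n e))\<^sup>2) \<le> exp (- s * n) * card (W n)" for n
      proof -
        have "(\<Sum>e\<in>F. (L2_norm M (component n e))\<^sup>2) \<le> (\<Sum>e\<in>F. \<Sum>w\<in>W n. (norm (L2_inner M e (u n w)))\<^sup>2)"
          by (intro sum_mono component_norm_le_proj FL2)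
        also have "\<dots> = (\<Sum>w\<in>W n. \<Sum>e\<in>F. (norm (L2_inner M (u n w) e))\<^sup>2)"
          by (subst sum.swap) (simp add: norm_L2_inner_commute)
        also have "\<dots> \<le> (\<Sum>w\<in>W n. (L2_norm M (u n w))\<^sup>2)"
          using F by (intro sum_mono L2_Bessel L2_orthonormal_subset[OF on]) auto
        also have "\<dots> = card (W n)" by (simp add: L2_orthonormal_norm[OF orthonormal])
        finally show ?thesis by (simp add: sum_distrib_left[symmetric])
      qed
      then show "(\<Sum>e\<in>F. Re (L2_inner M (op_app (exp_op s) e) e)) \<le> (\<Sum>n. exp (- s * n) * card (W n))"
        by (rule sums_le[OF _ sums_sum[OF q(1)[OF FL2]] summable_sums[OF sum]])
    qed
  qed (use q_nonneg L2_orthonormalD(1)[OF on] in auto)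
  ultimately show ?thesis unfolding trace_class_def using bd E by blast
qed

text \<open>
  Let \<open>p\<close> be the sum of the components of \<open>f\<close> up to \<open>N\<close>, and \<open>r = f - p\<close>. The operator \<open>P\<close> is diagonal on the
  eigenspaces, so the mixed terms \<open>\<langle>P p, r\<rangle>\<close> and \<open>\<langle>P r, p\<rangle>\<close> vanish, \<open>\<langle>P p, p\<rangle>\<close> is at least \<open>exp (- s N)\<close>
  times the squared norm of \<open>p\<close>, and \<open>\<langle>P r, r\<rangle>\<close> is non-negative. Finally \<open>r\<close> is orthogonal to \<open>C N\<close>, so
  \<open>p\<close> has the same coefficients as \<open>f\<close> with respect to the basis of \<open>C N\<close>.
\<close>

lemma absolute_value_exp_op_lower_bound:
  fixes s :: real
  assumes s: "s > 0" and abs: "L2_absolute_value M (exp_op s) P" and f: "f \<in> L2 M"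
  shows "exp (- s * N) * (\<Sum>w\<in>W N. (norm (L2_inner M f (u N w)))\<^sup>2) \<le> Re (L2_inner M (op_app P f) f)"
proof -
  note bd = exp_op_bounded[OF s]
  have P: "L2_positive_operator M P" using abs by (simp add: L2_absolute_value_def)
  then have bP: "L2_bounded_operator M P"
    and pos: "\<And>f. f \<in> L2 M \<Longrightarrow> 0 \<le> Re (L2_inner M (op_app P f) f)"
    by (auto simp: L2_positive_operator_def)
  note selfadj = L2_positive_operator_selfadjoint[OF P]
  note appP = op_app_in_graph(2)[OF bP]
  have eig: "L2_inner M (op_app P k) g = of_real (exp (- s * n)) * L2_inner M k g"
    if k: "k \<in> eigenspace n" and g: "g \<in> L2 M" for n k g
  proof (rule L2_absolute_value_eigenvector[OF bd abs eigenspace_L2[OF k] _ _ _ g])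
    have graph: "(k, \<lambda>x. of_real (exp (- s * n)) * k x) \<in> exp_op s"
      unfolding exp_op_iff
    proof (intro conjI allI ballI)
      fix m k' assume "k' \<in> eigenspace m"
      then show "L2_inner M (\<lambda>x. of_real (exp (- s * n)) * k x) k' = of_real (exp (- s * m)) * L2_inner M k k'"
        unfolding L2_inner_scale_left using eigenspace_orthogonal[OF k, of k' m] by (cases "m = n") auto
    qed (use eigenspace_L2[OF k] in auto)
    fix g assume g: "g \<in> L2 M"
    show "L2_inner M (op_app (exp_op s) k) g = of_real (exp (- s * n)) * L2_inner M k g"
      using L2_inner_op_app[OF bd graph g] by (simp only: L2_inner_scale_left)
    have "L2_inner M (op_app (exp_op s) g) k = of_real (exp (- s * n)) * L2_inner M g k"
      using op_app_in_graph(1)[OF bd g] k by (simp only: exp_op_iff)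
    then show "L2_inner M k (op_app (exp_op s) g) = of_real (exp (- s * n)) * L2_inner M k g"
      by (subst (1 2) L2_inner_commute) simp
  qed simp
  define p where "p = (\<lambda>x. \<Sum>n\<le>N. component n f x)"
  define r where "r = (\<lambda>x. f x - p x)"
  have p: "p \<in> L2 M" using f unfolding p_def by (intro L2_sum component_L2)
  have r: "r \<in> L2 M" unfolding r_def by (intro L2_diff f p)
  have rK: "L2_inner M r k = 0" if "n \<le> N" "k \<in> eigenspace n" for n k
  proof -
    have "L2_inner M p k = (\<Sum>m\<le>N. L2_inner M (component m f) k)"
      unfolding p_def using f eigenspace_L2[OF that(2)] by (intro L2_inner_sum_left) auto
    also have "\<dots> = (\<Sum>m\<le>N. if m = n then L2_inner M (component n f) k else 0)"
      using eigenspace_orthogonal[OF component_K[OF f] that(2)] by (intro sum.cong) auto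
    finally have "L2_inner M p k = L2_inner M f k"
      using that component_inner[OF f that(2)] by simp
    then show ?thesis unfolding r_def using f p eigenspace_L2[OF that(2)] by (simp add: L2_inner_diff_left)
  qed
  have Pp: "L2_inner M (op_app P p) h = (\<Sum>n\<le>N. of_real (exp (- s * n)) * L2_inner M (component n f) h)"
    if h: "h \<in> L2 M" for h
  proof -
    have "L2_inner M (op_app P p) h = (\<Sum>n\<le>N. L2_inner M (component n f) (op_app P h))"
      unfolding selfadj[OF p h] unfolding p_def
      using f appP[OF h] by (intro L2_inner_sum_left) auto
    also have "\<dots> = (\<Sum>n\<le>N. of_real (exp (- s * n)) * L2_inner M (component n f) h)"
      using f h by (intro sum.cong refl) (simp only: selfadj[symmetric] component_L2 eig[OF component_K])
    finally show ?thesis .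
  qed
  have component_r: "L2_inner M (component n f) r = 0" if "n \<le> N" for n
    using rK[OF that component_K[OF f]] by (subst L2_inner_commute) simp
  have component_p: "L2_inner M (component n f) p = of_real ((L2_norm M (component n f))\<^sup>2)" if "n \<le> N" for n
  proof -
    have "L2_inner M (component n f) f = of_real ((L2_norm M (component n f))\<^sup>2)"
      using component_inner_self[OF f, of n] by (subst L2_inner_commute) simp
    moreover have "L2_inner M (component n f) f - L2_inner M (component n f) p = 0"
      using component_r[OF that] f p by (simp add: r_def L2_inner_diff_right)
    ultimately show ?thesis by simp
  qed
  have "f = (\<lambda>x. p x + r x)" by (simp add: r_def)
  then have "L2_inner M (op_app P f) f = L2_inner M (op_app P (\<lambda>x. p x + r x)) (\<lambda>x. p x + r x)" by simp
  also have "\<dots> = L2_inner M (op_app P p) p + L2_inner M (op_app P p) r +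
      (L2_inner M (op_app P r) p + L2_inner M (op_app P r) r)"
    using p r by (simp add: L2_inner_op_app_add[OF bP] L2_inner_add_right appP)
  also have "L2_inner M (op_app P p) r = 0" by (simp add: Pp[OF r] component_r)
  also have "L2_inner M (op_app P r) p = 0"
  proof -
    have "L2_inner M (op_app P r) p = cnj (L2_inner M (op_app P p) r)"
      unfolding selfadj[OF r p] by (rule L2_inner_commute)
    then show ?thesis by (simp add: Pp[OF r] component_r)
  qed
  also have "L2_inner M (op_app P p) p = of_real (\<Sum>n\<le>N. exp (- s * n) * (L2_norm M (component n f))\<^sup>2)"
    by (simp add: Pp[OF p] component_p)
  finally have "Re (L2_inner M (op_app P f) f) =
      (\<Sum>n\<le>N. exp (- s * n) * (L2_norm M (component n f))\<^sup>2) + Re (L2_inner M (op_app P r) r)" by simp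
  also have "\<dots> \<ge> (\<Sum>n\<le>N. exp (- s * N) * (L2_norm M (component n f))\<^sup>2) + 0"
    using s by (intro add_mono sum_mono mult_right_mono pos[OF r]) auto
  also have "(\<Sum>n\<le>N. exp (- s * N) * (L2_norm M (component n f))\<^sup>2) + 0 = exp (- s * N) * (L2_norm M p)\<^sup>2"
    unfolding p_def using f
    by (subst L2_norm_sum_orthogonal) (auto simp: sum_distrib_left intro: component_orthogonal)
  finally have main: "exp (- s * N) * (L2_norm M p)\<^sup>2 \<le> Re (L2_inner M (op_app P f) f)" .
  have "perp N r" by (rule perp_if_orthogonal_eigenspaces[OF r rK])
  then have "L2_inner M p (u N w) = L2_inner M f (u N w)" if "w \<in> W N" for w
    using that f p unfolding perp_def r_def by (auto simp: L2_inner_diff_left)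
  then have "(\<Sum>w\<in>W N. (norm (L2_inner M f (u N w)))\<^sup>2) \<le> (L2_norm M p)\<^sup>2"
    using L2_Bessel[OF orthonormal finite_W p, of N] by simp
  then have "exp (- s * N) * (\<Sum>w\<in>W N. (norm (L2_inner M f (u N w)))\<^sup>2) \<le> exp (- s * N) * (L2_norm M p)\<^sup>2"
    by (rule mult_left_mono) simp
  then show ?thesis using main by (rule order_trans)
qed

text \<open>
  Summing the lower bound over an orthonormal basis turns, by Parseval's identity for each
  \<open>u N w\<close>, the left-hand side into \<open>exp (- s N) card (W N)\<close>. The constant \<open>S\<close> is the trace.
\<close>

theorem trace_class_exp_op_dimension_bound:
  fixes s :: real
  assumes s: "s > 0" and tc: "trace_class M (exp_op s)"
  shows "\<exists>S. \<forall>N. card (W N) \<le> S * exp (s * N)"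
proof -
  obtain P E where abs: "L2_absolute_value M (exp_op s) P" and E: "L2_orthonormal_basis M E"
    and sum: "(\<lambda>e. Re (L2_inner M (op_app P e) e)) summable_on E"
    using tc by (auto simp: trace_class_def)
  note on = L2_orthonormal_basis_orthonormal[OF E]
  define S where "S = infsum (\<lambda>e. Re (L2_inner M (op_app P e) e)) E"
  have "card (W N) \<le> S * exp (s * N)" for N
  proof -
    have "((\<lambda>e. (norm (L2_inner M (u N w) e))\<^sup>2) has_sum 1) E" if "w \<in> W N" for w
      using L2_Parseval[OF E u_L2[OF that]] L2_orthonormal_norm[OF orthonormal that] by simp
    then have "((\<lambda>e. \<Sum>w\<in>W N. (norm (L2_inner M (u N w) e))\<^sup>2) has_sum (\<Sum>w\<in>W N. 1)) E"
      by (rule has_sum_sum)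
    then have "((\<lambda>e. exp (- s * N) * (\<Sum>w\<in>W N. (norm (L2_inner M (u N w) e))\<^sup>2)) has_sum
        (exp (- s * N) * card (W N))) E"
      by (simp add: has_sum_cmult_right)
    moreover have "((\<lambda>e. Re (L2_inner M (op_app P e) e)) has_sum S) E"
      unfolding S_def using sum by (rule has_sum_infsum)
    moreover have "exp (- s * N) * (\<Sum>w\<in>W N. (norm (L2_inner M (u N w) e))\<^sup>2) \<le> Re (L2_inner M (op_app P e) e)"
      if "e \<in> E" for e
      using absolute_value_exp_op_lower_bound[OF s abs L2_orthonormalD(1)[OF on that], of N]
      by (simp only: norm_L2_inner_commute[of M e])
    ultimately have "exp (- s * N) * card (W N) \<le> S" by (rule has_sum_mono)
    then show ?thesis by (simp add: exp_minus field_simps)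
  qed
  then show ?thesis by blast
qed

end

section \<open>Words of a subshift and entropy\<close>

text \<open>
  Fekete's lemma. For fixed \<open>m\<close>, division with remainder gives \<open>a n \<le> (n div m) a m + a (n mod m)\<close>,
  and the last term is bounded, so that \<open>a n / n\<close> is eventually close to \<open>a m / m\<close> or below. The limit is the infimum.
\<close>

lemma subadditive_convergent:
  fixes a :: "nat \<Rightarrow> real"
  assumes nonneg: "\<And>n. 0 \<le> a n" and sub: "\<And>m n. a (m + n) \<le> a m + a n"
  shows "convergent (\<lambda>n. a n / n)"
proof -
  define L where "L = (INF n\<in>{1..}. a n / real n)"
  have bdd: "bdd_below ((\<lambda>n. a n / real n) ` {1..})"
    using nonneg by (intro bdd_belowI2[where m = 0]) simp
  have lower: "L \<le> a n / n" if "n \<ge> 1" for n :: nat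
    unfolding L_def by (rule cINF_lower[OF bdd]) (use that in auto)
  have mult: "a (q * m + r) \<le> q * a m + a r" for q m r
  proof (induction q)
    case (Suc q)
    have "a (Suc q * m + r) \<le> a m + a (q * m + r)" using sub[of m "q * m + r"] by (simp add: add.assoc)
    then show ?case using Suc by (simp add: algebra_simps)
  qed simp
  have "(\<lambda>n. a n / n) \<longlonglongrightarrow> L"
  proof (rule LIMSEQ_I)
    fix \<epsilon> :: real assume \<epsilon>: "\<epsilon> > 0"
    obtain m :: nat where m: "m \<ge> 1" "a m / m < L + \<epsilon> / 2"
      using cINF_less_iff[OF _ bdd, folded L_def, of "L + \<epsilon> / 2"] \<epsilon> by auto
    define B where "B = (\<Sum>r<m. a r)"
    obtain N :: nat where N: "B / (\<epsilon> / 2) < N" using reals_Archimedean2 by blast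
    have "norm (a n / n - L) < \<epsilon>" if n: "n \<ge> Suc N" for n
    proof -
      have n0: "real n > 0" using n by simp
      have "a n = a ((n div m) * m + n mod m)" by simp
      also have "\<dots> \<le> real (n div m) * a m + a (n mod m)" by (rule mult)
      also have "a (n mod m) \<le> B"
        unfolding B_def using m(1) nonneg by (intro member_le_sum) auto
      also have "real (n div m) * a m \<le> (n / m) * a m"
        using nonneg of_nat_div_le_of_nat[of n m] by (intro mult_right_mono) auto
      finally have "a n / n \<le> ((n / m) * a m + B) / n"
        using n0 by (intro divide_right_mono) auto
      also have "\<dots> = a m / m + B / n" using n0 by (simp add: add_divide_distrib)
      also have "B / n < \<epsilon> / 2"
      proof -
        have "B / (\<epsilon> / 2) < n" using N n by linarith
        then show ?thesis using \<epsilon> n0 by (simp add: field_simps)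
      qed
      finally have "a n / n < L + \<epsilon>" using m(2) by simp
      then show ?thesis using lower[of n] n by simp
    qed
    then show "\<exists>no. \<forall>n\<ge>no. norm (a n / n - L) < \<epsilon>" by blast
  qed
  then show ?thesis by (rule convergentI)
qed

text \<open>
  The positions of a cylinder around the origin; starting at \<open>1 - \<lceil>n/2\<rceil>\<close> covers odd and even lengths at once.
\<close>

definition window :: "nat \<Rightarrow> int list" where
  "window n = [1 - int ((n + 1) div 2)..int n - int ((n + 1) div 2)]"

lemma map_upto_translate: "map (\<lambda>i. x (i + c)) [a..b] = map x [a + c..b + c]" for c :: int
  by (rule nth_equalityI) (auto simp: algebra_simps)

lemma length_window [simp]: "length (window n) = n"
  by (simp add: window_def)

lemma set_window_mono: "m \<le> n \<Longrightarrow> set (window m) \<subseteq> set (window n)"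
  by (auto simp: window_def)

lemma finite_subset_window:
  assumes "finite F" shows "\<exists>n. F \<subseteq> set (window n)"
  using assms
proof (induction F rule: finite_induct)
  case (insert i F)
  then obtain n where n: "F \<subseteq> set (window n)" by blast
  define m where "m = max n (2 * nat \<bar>i\<bar> + 1)"
  have "i \<in> set (window (2 * nat \<bar>i\<bar> + 1))" by (auto simp: window_def)
  then have "insert i F \<subseteq> set (window m)"
    using n set_window_mono[of n m] set_window_mono[of "2 * nat \<bar>i\<bar> + 1" m] by (auto simp: m_def)
  then show ?case by blast
qed simp

lemma cylinder_eq: "cylinder X w = {x \<in> X. map x (window (length w)) = w}"
proof (cases "odd (length w)")
  case True
  then obtain m where "length w = 2 * m + 1" by (rule oddE)
  then show ?thesis by (simp add: cylinder_def window_def Let_def)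
next
  case False
  then obtain m where "length w = 2 * m" by blast
  then show ?thesis by (simp add: cylinder_def window_def Let_def)
qed

lemma subshift_translate:
  assumes X: "shift ` X = X" and x: "x \<in> X" shows "(\<lambda>k. x (k + j)) \<in> X"
proof (induction j rule: int_induct[of _ 0])
  case base show ?case using x by simp
next
  case (step1 j)
  have "shift (\<lambda>k. x (k + j)) \<in> X" using step1 X by blast
  then show ?case by (simp add: shift_def algebra_simps)
next
  case (step2 j)
  then obtain z where z: "z \<in> X" "(\<lambda>k. x (k + j)) = shift z" using X by blast
  have "z k = x (k + (j - 1))" for k
    using fun_cong[OF z(2), of "k - 1"] by (simp add: shift_def algebra_simps)
  then have "z = (\<lambda>k. x (k + (j - 1)))" by auto
  then show ?case using z by simp
qed

lemma words_eq_windows: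
  assumes X: "shift ` X = X" shows "words X n = (\<lambda>x. map x (window n)) ` X"
proof -
  define c where "c = - int ((n + 1) div 2)"
  have win: "map (\<lambda>k. x (k + c)) [1..int n] = map x (window n)" for x :: "int \<Rightarrow> 'a"
    using map_upto_translate[of x c 1 "int n"] by (simp add: window_def c_def)
  show ?thesis
  proof (intro equalityI subsetI)
    fix w assume "w \<in> words X n"
    then obtain x where x: "x \<in> X" "w = map x [1..int n]" by (auto simp: words_def)
    have "w = map (\<lambda>k. x (k + - c)) (window n)" using win[of "\<lambda>k. x (k + - c)"] x by simp
    then show "w \<in> (\<lambda>x. map x (window n)) ` X" using subshift_translate[OF X x(1)] by blast
  next
    fix w assume "w \<in> (\<lambda>x. map x (window n)) ` X"
    then obtain x where x: "x \<in> X" "w = map x (window n)" by blast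
    then have "w = map (\<lambda>k. x (k + c)) [1..int n]" by (simp add: win)
    then show "w \<in> words X n" using subshift_translate[OF X x(1)] by (auto simp: words_def)
  qed
qed

text \<open>
  A word of length \<open>m + n\<close> is a word of length \<open>m\<close> followed by the first \<open>n\<close> letters of a translate.
\<close>

lemma words_add_subset:
  assumes X: "shift ` X = X"
  shows "words X (m + n) \<subseteq> (\<lambda>(v, w). v @ w) ` (words X m \<times> words X n)"
proof
  fix w assume "w \<in> words X (m + n)"
  then obtain x where x: "x \<in> X" "w = map x [1..int (m + n)]" by (auto simp: words_def)
  have "[1..int (m + n)] = [1..int m] @ [int m + 1..int (m + n)]"
    using upto_split2[of 1 "int m" "int (m + n)"] by (cases "m = 0") auto
  then have "w = map x [1..int m] @ map (\<lambda>k. x (k + int m)) [1..int n]"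
    using x(2) by (simp add: map_upto_translate add.commute)
  then show "w \<in> (\<lambda>(v, w). v @ w) ` (words X m \<times> words X n)"
    using x(1) subshift_translate[OF X x(1)] by (force simp: words_def)
qed

lemma card_words_add_le:
  assumes X: "shift ` X = X" and fin: "\<And>n. finite (words X n)"
  shows "card (words X (m + n)) \<le> card (words X m) * card (words X n)"
proof -
  have "card (words X (m + n)) \<le> card ((\<lambda>(v, w). v @ w) ` (words X m \<times> words X n))"
    using fin by (intro card_mono words_add_subset[OF X]) auto
  also have "\<dots> \<le> card (words X m \<times> words X n)" using fin by (intro card_image_le) auto
  finally show ?thesis by (simp add: card_cartesian_product)
qed

lemma card_words_pos: "\<lbrakk>X \<noteq> {}; finite (words X n)\<rbrakk> \<Longrightarrow> card (words X n) \<ge> 1"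
  by (auto simp: words_def Suc_le_eq card_gt_0_iff)

lemma subshift_entropy_limit:
  assumes X: "shift ` X = X" and fin: "\<And>n. finite (words X n)" and "X \<noteq> {}"
  shows "(\<lambda>n. ln (real (card (words X n))) / real n) \<longlonglongrightarrow> subshift_entropy X"
    and "0 \<le> subshift_entropy X"
proof -
  note pos = card_words_pos[OF assms(3) fin]
  have pos': "0 < card (words X n)" for n using pos[of n] by simp
  have ln0: "0 \<le> ln (real (card (words X n)))" for n using pos[of n] by simp
  have "convergent (\<lambda>n. ln (real (card (words X n))) / real n)"
  proof (rule subadditive_convergent[OF ln0])
    fix m n
    have "ln (real (card (words X (m + n)))) \<le> ln (real (card (words X m)) * real (card (words X n)))"
      using pos[of "m + n"] card_words_add_le[OF X fin, of m n]
      by (subst ln_le_cancel_iff) (auto simp flip: of_nat_mult simp: pos')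
    also have "\<dots> = ln (real (card (words X m))) + ln (real (card (words X n)))"
      using pos[of m] pos[of n] by (simp add: ln_mult)
    finally show "ln (real (card (words X (m + n)))) \<le> ln (real (card (words X m))) + ln (real (card (words X n)))" .
  qed
  then show lim: "(\<lambda>n. ln (real (card (words X n))) / real n) \<longlonglongrightarrow> subshift_entropy X"
    by (simp add: subshift_entropy_def convergent_LIMSEQ_iff)
  show "0 \<le> subshift_entropy X" by (rule LIMSEQ_le_const[OF lim]) (use ln0 in auto)
qed

text \<open>
  For \<open>t\<close> strictly between the entropy and \<open>s\<close>, the number of words is eventually at most \<open>exp (t n)\<close>,
  which leaves a geometric series with ratio \<open>exp (t - s)\<close>.
\<close>

lemma summable_card_words:
  fixes s :: real
  assumes X: "shift ` X = X" and fin: "\<And>n. finite (words X n)" and "X \<noteq> {}" and s: "s > subshift_entropy X"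
  shows "summable (\<lambda>n. exp (- s * n) * card (words X n))"
proof -
  define t where "t = (s + subshift_entropy X) / 2"
  have t: "subshift_entropy X < t" "t < s" using s by (auto simp: t_def)
  note pos = card_words_pos[OF assms(3) fin]
  have "\<forall>\<^sub>F n in sequentially. ln (real (card (words X n))) / real n < t"
    by (rule order_tendstoD(2)[OF subshift_entropy_limit(1)[OF assms(1-3)] t(1)])
  then have "\<forall>\<^sub>F n in sequentially. norm (exp (- s * n) * card (words X n)) \<le> exp (t - s) ^ n"
    using eventually_gt_at_top[of 0]
  proof eventually_elim
    case (elim n)
    then have "ln (real (card (words X n))) \<le> t * n" by (simp add: field_simps)
    then have "exp (ln (real (card (words X n)))) \<le> exp (t * n)" by simp
    then have "real (card (words X n)) \<le> exp (t * n)" using pos[of n] by simp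
    then have "exp (- s * n) * card (words X n) \<le> exp (- s * n) * exp (t * n)"
      by (intro mult_left_mono) auto
    also have "\<dots> = exp (t - s) ^ n"
      by (simp add: exp_of_nat_mult[symmetric] mult_exp_exp algebra_simps)
    finally show ?case by simp
  qed
  then show ?thesis by (rule summable_comparison_test_ev) (use t(2) in \<open>simp add: summable_geometric\<close>)
qed

lemma subshift_entropy_le:
  assumes X: "shift ` X = X" and fin: "\<And>n. finite (words X n)" and "X \<noteq> {}"
    and bound: "\<And>n. card (words X n) \<le> S * exp (s * n)"
  shows "subshift_entropy X \<le> s"
proof (rule LIMSEQ_le[OF subshift_entropy_limit(1)[OF assms(1-3)]])
  note pos = card_words_pos[OF assms(3) fin]
  have S: "S > 0" using bound[of 0] pos[of 0] by simp
  show "(\<lambda>n. ln S / real n + s) \<longlonglongrightarrow> s"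
    using tendsto_add[OF lim_const_over_n[of "ln S"] tendsto_const[of s]] by simp
  have "ln (real (card (words X n))) / n \<le> ln S / n + s" if "n \<ge> 1" for n
  proof -
    have "ln (real (card (words X n))) \<le> ln (S * exp (s * n))"
      using bound[of n] pos[of n] S by (subst ln_le_cancel_iff) auto
    also have "\<dots> = ln S + s * n" using S by (simp add: ln_mult)
    finally show ?thesis using that by (simp add: field_simps)
  qed
  then show "\<exists>N. \<forall>n\<ge>N. ln (real (card (words X n))) / real n \<le> ln S / real n + s" by blast
qed

section \<open>The filtration of a subshift\<close>

locale subshift_measure = prob_space M for M :: "(int \<Rightarrow> 'a) measure" +
  fixes A :: "'a set" and X :: "(int \<Rightarrow> 'a) set"
  assumes finite_A: "finite A" and subshift: "subshift A X"
    and borel: "borel_measure_on (subtopology (full_shift_topology A) X) M"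
    and support: "measure_support (subtopology (full_shift_topology A) X) M = X"
begin

lemma X_nonempty: "X \<noteq> {}" and shift_X: "shift ` X = X"
  using subshift by (auto simp: subshift_def)

lemma topspace_full_shift: "topspace (full_shift_topology A) = (UNIV \<rightarrow>\<^sub>E A)"
  by (simp add: full_shift_topology_def)

lemma X_subset: "X \<subseteq> (UNIV \<rightarrow>\<^sub>E A)"
  using subshift closedin_subset[of "full_shift_topology A" X] by (simp add: subshift_def topspace_full_shift)

lemma X_in_alphabet: "x \<in> X \<Longrightarrow> x i \<in> A"
  using X_subset by auto

lemma topspace_X: "topspace (subtopology (full_shift_topology A) X) = X"
  using X_subset by (auto simp: topspace_full_shift)

lemma space_X: "space M = X"
  using borel topspace_X by (simp add: borel_measure_on_def)

lemma sets_X: "sets M = sigma_sets X {U. openin (subtopology (full_shift_topology A) X) U}"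
  using borel topspace_X by (simp add: borel_measure_on_def)

lemma finite_words: "finite (words X n)"
proof (rule finite_subset[OF _ finite_lists_length_eq[OF finite_A]])
  show "words X n \<subseteq> {w. set w \<subseteq> A \<and> length w = n}" by (auto simp: words_def X_in_alphabet)
qed

lemmas words_windows = words_eq_windows[OF shift_X]

lemma length_words: "w \<in> words X n \<Longrightarrow> length w = n"
  by (auto simp: words_def)

lemma cylinder_words: "w \<in> words X n \<Longrightarrow> cylinder X w = {x \<in> X. map x (window n) = w}"
  by (simp add: cylinder_eq length_words)

lemma cylinder_nonempty: "w \<in> words X n \<Longrightarrow> \<exists>x. x \<in> cylinder X w"
  by (auto simp: cylinder_words) (auto simp: words_windows)

lemma openin_cylinder:
  assumes "w \<in> words X n"
  shows "openin (subtopology (full_shift_topology A) X) (cylinder X w)"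
proof -
  obtain x where x: "x \<in> X" "w = map x (window n)" using assms by (auto simp: words_windows)
  define U where "U = (\<Pi>\<^sub>E i\<in>UNIV. if i \<in> set (window n) then {x i} else A)"
  have "openin (full_shift_topology A) U"
    unfolding U_def full_shift_topology_def
  proof (subst openin_PiE_gen, intro disjI2 conjI ballI)
    have "{i \<in> UNIV. (if i \<in> set (window n) then {x i} else A) \<noteq> topspace (discrete_topology A)} \<subseteq> set (window n)"
      by auto
    then show "finite {i \<in> UNIV. (if i \<in> set (window n) then {x i} else A) \<noteq> topspace (discrete_topology A)}"
      by (rule finite_subset) simp
  qed (use x X_subset in auto)
  moreover have "cylinder X w = {y \<in> X. \<forall>i\<in>set (window n). y i = x i}"
    using cylinder_words[OF assms] unfolding x(2) by simp
  then have "cylinder X w = U \<inter> X"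
    by (auto simp: U_def PiE_iff X_in_alphabet split: if_splits)
  ultimately show ?thesis by (auto simp: openin_subtopology)
qed

lemma cylinder_in_sets: "w \<in> words X n \<Longrightarrow> cylinder X w \<in> sets M"
  unfolding sets_X using openin_cylinder by (intro sigma_sets.Basic) auto

lemma measure_cylinder_pos: assumes "w \<in> words X n" shows "measure M (cylinder X w) > 0"
proof -
  obtain x where x: "x \<in> cylinder X w" using cylinder_nonempty[OF assms] by blast
  then have "x \<in> X" by (simp add: cylinder_eq)
  then have "emeasure M (cylinder X w) > 0"
    using support openin_cylinder[OF assms] x by (auto simp: measure_support_def)
  then show ?thesis by (simp add: emeasure_eq_measure)
qed

text \<open>
  An open set restricts only finitely many coordinates around each of its points, and these
  fit into a window.
\<close>

lemma open_contains_cylinder: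
  assumes U: "openin (subtopology (full_shift_topology A) X) U" and x: "x \<in> U"
  shows "\<exists>n. \<exists>w\<in>words X n. x \<in> cylinder X w \<and> cylinder X w \<subseteq> U"
proof -
  obtain V where V: "openin (full_shift_topology A) V" "U = V \<inter> X"
    using U by (auto simp: openin_subtopology)
  then obtain B where B: "finite {i \<in> UNIV. B i \<noteq> topspace (discrete_topology A)}"
      "x \<in> Pi\<^sub>E UNIV B" "Pi\<^sub>E UNIV B \<subseteq> V"
    using x unfolding full_shift_topology_def openin_product_topology_alt by blast
  obtain n where n: "{i. B i \<noteq> A} \<subseteq> set (window n)"
    using finite_subset_window[OF B(1)] by auto
  have xX: "x \<in> X" using x V by simp
  let ?w = "map x (window n)"
  have w: "?w \<in> words X n" using xX by (auto simp: words_windows)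
  have "cylinder X ?w \<subseteq> U"
  proof
    fix y assume "y \<in> cylinder X ?w"
    then have y: "y \<in> X" "\<And>i. i \<in> set (window n) \<Longrightarrow> y i = x i" by (auto simp: cylinder_words[OF w])
    have "y i \<in> B i" for i
    proof (cases "i \<in> set (window n)")
      case True then show ?thesis using y(2) B(2) by auto
    next
      case False
      then have "B i = A" using n by auto
      then show ?thesis using y(1) X_subset by auto
    qed
    then show "y \<in> U" using B(3) V(2) y(1) by auto
  qed
  moreover have "x \<in> cylinder X ?w" using xX by (simp add: cylinder_words[OF w])
  ultimately show ?thesis using w by blast
qed

text \<open>
  The empty set is included to obtain stability under intersection.
\<close>

definition cylinders :: "(int \<Rightarrow> 'a) set set" where
  "cylinders = insert {} (\<Union>n. cylinder X ` words X n)"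

lemma sets_cylinders: "sets M = sigma_sets X cylinders"
proof
  have "cylinders \<subseteq> sets M" using cylinder_in_sets by (auto simp: cylinders_def)
  from sets.sigma_sets_subset[OF this] show "sigma_sets X cylinders \<subseteq> sets M"
    by (simp only: space_X)
  show "sets M \<subseteq> sigma_sets X cylinders"
    unfolding sets_X
  proof (rule sigma_sets_mono, rule subsetI)
    fix U assume "U \<in> {U. openin (subtopology (full_shift_topology A) X) U}"
    then have U: "openin (subtopology (full_shift_topology A) X) U" by simp
    have "U = \<Union>{G \<in> cylinders. G \<subseteq> U}"
    proof (intro equalityI subsetI)
      fix x assume "x \<in> U"
      then obtain n w where "w \<in> words X n" "x \<in> cylinder X w" "cylinder X w \<subseteq> U"
        using open_contains_cylinder[OF U] by blast
      then show "x \<in> \<Union>{G \<in> cylinders. G \<subseteq> U}" unfolding cylinders_def by blast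
    qed blast
    moreover have "countable cylinders"
      unfolding cylinders_def using finite_words by (auto intro!: countable_UN intro: countable_finite)
    then have "countable {G \<in> cylinders. G \<subseteq> U}" by (rule countable_subset[rotated]) blast
    then have "\<Union>{G \<in> cylinders. G \<subseteq> U} \<in> sigma_sets X cylinders"
      by (rule sigma_sets_UNION) (blast intro: sigma_sets.Basic)
    ultimately show "U \<in> sigma_sets X cylinders" by simp
  qed
qed

lemma cylinder_mono:
  assumes "x \<in> cylinder X v" "x \<in> cylinder X w" "length v \<le> length w"
  shows "cylinder X w \<subseteq> cylinder X v"
proof
  fix y assume y: "y \<in> cylinder X w"
  have "\<forall>i\<in>set (window (length w)). y i = x i"
    using y assms(2) unfolding cylinder_eq map_eq_conv[symmetric] by simp
  then have "\<forall>i\<in>set (window (length v)). y i = x i"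
    using set_window_mono[OF assms(3)] by blast
  then have "map y (window (length v)) = map x (window (length v))" by simp
  also have "\<dots> = v" using assms(1) by (simp add: cylinder_eq)
  finally have "map y (window (length v)) = v" .
  then show "y \<in> cylinder X v" using y by (simp add: cylinder_eq)
qed

lemma Int_stable_cylinders: "Int_stable cylinders"
proof (rule Int_stableI)
  fix a b assume ab: "a \<in> cylinders" "b \<in> cylinders"
  show "a \<inter> b \<in> cylinders"
  proof (cases "a \<inter> b = {}")
    case True then show ?thesis by (simp add: cylinders_def)
  next
    case False
    then obtain x v w where x: "a = cylinder X v" "b = cylinder X w" "x \<in> a" "x \<in> b"
      using ab by (auto simp: cylinders_def)
    then have "a \<inter> b = a \<or> a \<inter> b = b"
      using cylinder_mono[of x v w] cylinder_mono[of x w v] by (cases "length v \<le> length w") auto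
    then show ?thesis using ab by auto
  qed
qed

lemma indicator_L2:
  assumes "B \<in> sets M" shows "(indicator B :: _ \<Rightarrow> complex) \<in> L2 M"
proof -
  have "(norm (indicator B x :: complex))\<^sup>2 = indicat_real B x" for x
    by (simp add: indicator_def)
  then show ?thesis using assms by (simp add: L2_def integrable_real_indicator emeasure_eq_measure)
qed

lemma L2_inner_indicator: "L2_inner M f (indicator B) = set_lebesgue_integral M B f"
proof -
  have "f x * cnj (indicator B x) = indicat_real B x *\<^sub>R f x" for x
    by (simp add: indicator_def)
  then show ?thesis by (simp add: L2_inner_def set_lebesgue_integral_def)
qed

text \<open>
  The sets over which \<open>f\<close> has integral zero contain the cylinders, and they are closed under complements
  and countable disjoint unions. By Dynkin's theorem they are all measurable sets.
\<close>

lemma L2_null_if_orthogonal_cylinders: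
  assumes f: "f \<in> L2 M" and "\<And>n w. w \<in> words X n \<Longrightarrow> L2_inner M f (indicator (cylinder X w)) = 0"
  shows "L2_norm M f = 0"
proof -
  have int: "integrable M f" by (rule L1_norm_le_L2_norm(1)[OF f])
  have set_int: "set_integrable M B f" if "B \<in> sets M" for B
    unfolding set_integrable_def by (rule integrable_mult_indicator[OF that int])
  have "[] \<in> words X 0" using X_nonempty by (auto simp: words_def)
  moreover have "cylinder X [] = X" by (simp add: cylinder_eq window_def)
  ultimately have whole: "set_lebesgue_integral M X f = 0"
    using assms(2)[of "[]" 0] by (simp add: L2_inner_indicator)
  have "set_lebesgue_integral M B f = 0" if "B \<in> sets M" for B
  proof -
    have "cylinders \<subseteq> Pow X" by (auto simp: cylinders_def cylinder_eq)
    from Int_stable_cylinders this that[unfolded sets_cylinders] show ?thesis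
    proof (induction rule: sigma_sets_induct_disjoint)
      case (basic B)
      then show ?case using assms(2)
        by (auto simp: cylinders_def L2_inner_indicator) (simp add: set_lebesgue_integral_def)
    next
      case empty show ?case by (simp add: set_lebesgue_integral_def)
    next
      case (compl B)
      have B: "B \<in> sets M" using compl.hyps by (simp add: sets_cylinders)
      have "X = B \<union> (X - B)" using sets.sets_into_space[OF B] space_X by auto
      moreover have "set_lebesgue_integral M (B \<union> (X - B)) f =
          set_lebesgue_integral M B f + set_lebesgue_integral M (X - B) f"
        using B sets.compl_sets[OF B] space_X by (intro set_integral_Un set_int) auto
      ultimately show ?case using whole compl.IH by simp
    next
      case (union B)
      have "range B \<subseteq> sets M" using union.hyps by (simp add: sets_cylinders)
      then have "set_lebesgue_integral M (\<Union>i. B i) f = (\<Sum>i. set_lebesgue_integral M (B i) f)"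
        using union.hyps(1) by (intro lebesgue_integral_countable_add set_int) (auto simp: disjoint_family_on_def)
      then show ?case using union.IH by simp
    qed
  qed
  then have "AE x in M. f x = 0" by (rule density_zero[OF int])
  then show ?thesis using L2_norm_eq_0_iff_AE[OF f] by simp
qed

text \<open>
  The normalised characteristic functions of cylinders. At \<open>n = 0\<close> the only cylinder is \<open>X\<close>, of measure one.
  There the value is one also outside \<open>X\<close>, so that the span is literally the space of constant functions.
\<close>

definition cyl_vec :: "nat \<Rightarrow> 'a list \<Rightarrow> (int \<Rightarrow> 'a) \<Rightarrow> complex" where
  "cyl_vec n w x = (if n = 0 then 1 else
     of_real (1 / sqrt (measure M (cylinder X w))) * indicator (cylinder X w) x)"

lemma words_0: "words X 0 = {[]}"
  using X_nonempty by (auto simp: words_def)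

lemma cyl_vec_on_X:
  assumes "w \<in> words X n" "x \<in> X"
  shows "cyl_vec n w x = of_real (1 / sqrt (measure M (cylinder X w))) * indicator (cylinder X w) x"
proof (cases "n = 0")
  case True
  then have "cylinder X w = space M" using assms words_0 by (simp add: cylinder_eq window_def space_X)
  then show ?thesis using True assms prob_space by (simp add: cyl_vec_def space_X)
qed (simp add: cyl_vec_def)

lemma cyl_vec_inner:
  assumes "w \<in> words X n"
  shows "L2_inner M f (cyl_vec n w) =
    of_real (1 / sqrt (measure M (cylinder X w))) * L2_inner M f (indicator (cylinder X w))"
proof -
  have "L2_inner M f (cyl_vec n w) =
      L2_inner M f (\<lambda>x. of_real (1 / sqrt (measure M (cylinder X w))) * indicator (cylinder X w) x)"
    unfolding L2_inner_def using assms
    by (intro Bochner_Integration.integral_cong) (simp_all only: cyl_vec_on_X space_X)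
  then show ?thesis unfolding L2_inner_scale_right by simp
qed

lemma cyl_vec_inner_eq_0_iff:
  "w \<in> words X n \<Longrightarrow> L2_inner M f (cyl_vec n w) = 0 \<longleftrightarrow> L2_inner M f (indicator (cylinder X w)) = 0"
  using measure_cylinder_pos[of w n] by (simp add: cyl_vec_inner)

lemma cyl_vec_L2: assumes "w \<in> words X n" shows "cyl_vec n w \<in> L2 M"
proof (cases "n = 0")
  case True then show ?thesis by (simp add: cyl_vec_def[abs_def] L2_def)
next
  case False
  then have "cyl_vec n w = (\<lambda>x. of_real (1 / sqrt (measure M (cylinder X w))) * indicator (cylinder X w) x)"
    by (auto simp: cyl_vec_def)
  then show ?thesis by (simp only: L2_scale[OF indicator_L2[OF cylinder_in_sets[OF assms]]])
qed

lemma cyl_vec_orthonormal: "L2_orthonormal M (words X n) (cyl_vec n)"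
  unfolding L2_orthonormal_def
proof (intro conjI ballI cyl_vec_L2)
  fix v w assume v: "v \<in> words X n" and w: "w \<in> words X n"
  have "L2_inner M (indicator (cylinder X w)) (cyl_vec n v) =
      of_real (1 / sqrt (measure M (cylinder X v))) * L2_inner M (indicator (cylinder X w)) (indicator (cylinder X v))"
    by (rule cyl_vec_inner[OF v])
  have eq: "L2_inner M (cyl_vec n v) (cyl_vec n w) =
      of_real (1 / sqrt (measure M (cylinder X w))) * (of_real (1 / sqrt (measure M (cylinder X v))) *
      L2_inner M (indicator (cylinder X v)) (indicator (cylinder X w)))"
    unfolding cyl_vec_inner[OF w]
    by (subst (1 2) L2_inner_commute) (simp add: cyl_vec_inner[OF v])
  have ind: "L2_inner M (indicator (cylinder X v)) (indicator (cylinder X w)) =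
      of_real (measure M (cylinder X v \<inter> cylinder X w))"
  proof -
    have "indicator (cylinder X v) x * cnj (indicator (cylinder X w) x) =
        complex_of_real (indicator (cylinder X v \<inter> cylinder X w) x)" for x
      by (simp add: indicator_def)
    moreover have "cylinder X v \<inter> cylinder X w \<inter> space M = cylinder X v \<inter> cylinder X w"
      by (auto simp: cylinder_eq space_X)
    ultimately show ?thesis by (simp add: L2_inner_def del: of_real_indicator)
  qed
  show "L2_inner M (cyl_vec n v) (cyl_vec n w) = of_bool (v = w)"
  proof (cases "v = w")
    case True
    have "sqrt (measure M (cylinder X w)) * sqrt (measure M (cylinder X w)) = measure M (cylinder X w)"
      by simp
    then show ?thesis using True measure_cylinder_pos[OF w] unfolding eq ind
      by (simp flip: of_real_mult)
  next
    case False
    then have "cylinder X v \<inter> cylinder X w = {}" by (auto simp: cylinder_words[OF v] cylinder_words[OF w])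
    then show ?thesis using False unfolding eq ind by simp
  qed
qed

text \<open>
  A cylinder is the disjoint union of the cylinders of the next length inside it.
\<close>

lemma indicator_cylinder_split:
  assumes w: "w \<in> words X n" and x: "x \<in> X"
  shows "(indicator (cylinder X w) x :: complex) =
    (\<Sum>v\<in>{v \<in> words X (Suc n). cylinder X v \<subseteq> cylinder X w}. indicator (cylinder X v) x)"
proof -
  define v where "v = map x (window (Suc n))"
  have v: "v \<in> words X (Suc n)" using x by (auto simp: v_def words_windows)
  have xv: "x \<in> cylinder X v" using x by (simp add: cylinder_words[OF v] flip: v_def)
  have "x \<in> cylinder X w \<longleftrightarrow> cylinder X v \<subseteq> cylinder X w"
    using xv cylinder_mono[of x w v] length_words[OF v] length_words[OF w] by auto
  moreover have "indicator (cylinder X v') x = (if v' = v then 1 else 0 :: complex)"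
    if "v' \<in> words X (Suc n)" for v'
    using x by (auto simp: indicator_def cylinder_words[OF that] v_def)
  then have "(\<Sum>v'\<in>{v' \<in> words X (Suc n). cylinder X v' \<subseteq> cylinder X w}. indicator (cylinder X v') x) =
      (\<Sum>v'\<in>{v' \<in> words X (Suc n). cylinder X v' \<subseteq> cylinder X w}. if v' = v then 1 else 0 :: complex)"
    by (intro sum.cong) auto
  ultimately show ?thesis using v finite_words by (simp add: indicator_def)
qed

sublocale L2_filtration M "words X" cyl_vec
proof
  fix n show "finite (words X n)" by (rule finite_words)
  show "L2_orthonormal M (words X n) (cyl_vec n)" by (rule cyl_vec_orthonormal)
next
  fix f n w
  assume f: "f \<in> L2 M" and perp: "\<forall>v\<in>words X (Suc n). L2_inner M f (cyl_vec (Suc n) v) = 0"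
    and w: "w \<in> words X n"
  have "L2_inner M f (indicator (cylinder X w)) =
      L2_inner M f (\<lambda>x. \<Sum>v\<in>{v \<in> words X (Suc n). cylinder X v \<subseteq> cylinder X w}. indicator (cylinder X v) x)"
    unfolding L2_inner_def using indicator_cylinder_split[OF w]
    by (intro Bochner_Integration.integral_cong) (simp_all add: space_X)
  also have "\<dots> = (\<Sum>v\<in>{v \<in> words X (Suc n). cylinder X v \<subseteq> cylinder X w}. L2_inner M f (indicator (cylinder X v)))"
    using f cylinder_in_sets by (intro L2_inner_sum_right) (auto intro: indicator_L2)
  also have "\<dots> = 0" using perp by (intro sum.neutral) (auto simp: cyl_vec_inner_eq_0_iff)
  finally show "L2_inner M f (cyl_vec n w) = 0" using w by (simp add: cyl_vec_inner_eq_0_iff)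
next
  fix f assume "f \<in> L2 M" "\<forall>n. \<forall>w\<in>words X n. L2_inner M f (cyl_vec n w) = 0"
  then show "L2_norm M f = 0"
    by (intro L2_null_if_orthogonal_cylinders) (auto simp: cyl_vec_inner_eq_0_iff)
qed

lemma C_eq_cyl_space: "C n = cyl_space X (int n)"
proof (cases "n = 0")
  case True
  then show ?thesis by (auto simp: C_def cyl_space_def words_0 cyl_vec_def intro!: exI[of _ "\<lambda>_. _"])
next
  case False
  define r where "r w = sqrt (measure M (cylinder X w))" for w
  have r: "r w \<noteq> 0" if "w \<in> words X n" for w using measure_cylinder_pos[OF that] by (simp add: r_def)
  have vec: "cyl_vec n w x = of_real (1 / r w) * indicator (cylinder X w) x" for w x
    using False by (simp add: cyl_vec_def r_def)
  show ?thesis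
  proof (intro equalityI subsetI)
    fix f assume "f \<in> C n"
    then obtain c where "f = (\<lambda>x. \<Sum>w\<in>words X n. c w * cyl_vec n w x)" by (auto simp: C_def)
    then have "f = (\<lambda>x. \<Sum>w\<in>words X n. (c w * of_real (1 / r w)) * indicator (cylinder X w) x)"
      by (simp only: vec mult.assoc)
    then show "f \<in> cyl_space X (int n)"
      using False unfolding cyl_space_def by (auto intro!: exI[of _ "\<lambda>w. c w * of_real (1 / r w)"])
  next
    fix f assume "f \<in> cyl_space X (int n)"
    then obtain c where "f = (\<lambda>x. \<Sum>w\<in>words X n. c w * indicator (cylinder X w) x)"
      using False by (auto simp: cyl_space_def)
    then have "f = (\<lambda>x. \<Sum>w\<in>words X n. (c w * of_real (r w)) * cyl_vec n w x)"
      using r by (auto simp: vec intro!: sum.cong)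
    then show "f \<in> C n" by (auto simp: C_def)
  qed
qed

lemma eigenspace_eq_cyl_space: "eigenspace n = cyl_space X (int n) \<inter> L2_orthogonal M (cyl_space X (int n - 1))"
proof (cases n)
  case 0
  have "cyl_space X (int 0 - 1) = {\<lambda>_. 0}" by (simp add: cyl_space_def)
  then show ?thesis
    using 0 C_L2[of _ 0] C_eq_cyl_space[of 0] by (auto simp: eigenspace_def L2_orthogonal_def)
next
  case (Suc m)
  then show ?thesis using C_eq_cyl_space[of m] C_eq_cyl_space[of "Suc m"] by (simp add: eigenspace_def)
qed

lemma D_operator_eq_number_op: "D_operator X M = number_op"
  unfolding D_operator_def number_op_def eigenspace_eq_cyl_space ..

end

section \<open>Trace class and entropy\<close>

theorem theorem4p1:
  fixes A :: "'a set" and X :: "(int \<Rightarrow> 'a) set" and M :: "(int \<Rightarrow> 'a) measure"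
  assumes "finite A"
    and "subshift A X"
    and "borel_measure_on (subtopology (full_shift_topology A) X) M"
    and "prob_space M"
    and "invariant_measure shift M"
    and "measure_support (subtopology (full_shift_topology A) X) M = X"
  shows "(\<forall>s. s > subshift_entropy X \<longrightarrow> trace_class M (op_exp M (- s) (D_operator X M))) \<and>
         (\<forall>s>0. trace_class M (op_exp M (- s) (D_operator X M)) \<longrightarrow> s \<ge> subshift_entropy X)"
proof -
  interpret prob_space M by fact
  interpret subshift_measure M A X by unfold_locales fact+
  note ent = shift_X finite_words X_nonempty
  show ?thesis
    unfolding D_operator_eq_number_op
  proof (intro conjI allI impI)
    fix s assume s: "s > subshift_entropy X"
    with subshift_entropy_limit(2)[OF ent] have "s > 0" by simp
    then show "trace_class M (exp_op s)"
      by (rule exp_op_trace_class) (rule summable_card_words[OF ent s])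
  next
    fix s :: real assume "s > 0" "trace_class M (exp_op s)"
    from trace_class_exp_op_dimension_bound[OF this] obtain S
      where "\<And>N. card (words X N) \<le> S * exp (s * N)" by blast
    then show "subshift_entropy X \<le> s" by (rule subshift_entropy_le[OF ent])
  qed
qed

end
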